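(* Let $N_c,N_s$ be powers of two, $N_c,N_s\ge 2$, let $1\le K\le N_s$, and let $A=(a_{ij})\in\mathbb{R}^{N_c\times N_s}$ satisfy $\sum_{i,j}a_{ij}^2=1$. For each $j\in\{1,\dots,K\}$ let $P_j$ be a butterfly circuit on $N_c$ qubits with arbitrary $RBS$ angles, let $P_j'$ be the circuit with the same $RBS$ gates (same qubits, same angles) applied in reversed order, let $W_{P_j},W_{P_j'}\in\mathbb{R}^{N_c\times N_c}$ be the matrices of $P_j,P_j'$ restricted to the unary basis, and put $W_Q^j=W_{P_j'}W_{P_j}$. Then the sequential quantum Fourier layer, a single circuit on $N_c+N_s$ qubits started in $|0\rangle^{\otimes N_c}\otimes|0\rangle^{\otimes N_s}$, produces the state $$\sum_{i=1}^{N_c}\sum_{j=1}^{N_s} y_{ij}\,|e_i\rangle|e_j\rangle ,$$ where $Y=(y_{ij})$ is the output of the classical Fourier layer on input $A$ with $K$ modes and weight matrices $W^j=W_Q^j$, $1\le j\le K$. Its depth is $O\big(KN_c+N_c\log N_s\big)$.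
   Context: **Unary states and gates.** On $n$ qubits, $|e_i\rangle$ is the computational basis state with a single $1$, on qubit $i$. $RBS(\theta)$ is the two-qubit gate fixing $|00\rangle,|11\rangle$ with $|01\rangle\mapsto\cos\theta|01\rangle-\sin\theta|10\rangle$ and $|10\rangle\mapsto\sin\theta|01\rangle+\cos\theta|10\rangle$; it preserves Hamming weight, so any circuit of $RBS$ gates maps the span of the unary states to itself, and its restriction to that span is a real orthogonal matrix. **Butterfly circuit.** On $N=2^a$ qubits labelled by $\{0,\dots,2^a-1\}$ in binary, it has $a$ layers of $RBS$ gates; in each layer one bit position is fixed (each position is used in exactly one layer, positions ordered as in the FFT butterfly) and an $RBS$ gate with its own angle is applied to every pair of qubits whose labels differ exactly in that bit. **Fourier transform.** For $x\in\mathbb{C}^M$, $FT(x)=\hat x$ with $\hat x_k=\frac1{\sqrt M}\sum_j \omega^{(j-1)(k-1)}x_j$, $\omega=e^{2\pi i/M}$, and $IFT$ is its inverse. For $M$ a power of two, the unary $QFT$ is a circuit on $M$ qubits of depth $O(\log M)$ with $\sum_j x_j|e_j\rangle\mapsto\sum_j\hat x_j|e_j\rangle$ (a fixed relabelling of the input qubits is free); $IQFT$ is its inverse. **Classical Fourier layer** (with $K$ modes and weight matrices $W^1,\dots,W^K\in\mathbb{R}^{N_c\times N_c}$). Given $A$ with rows $a_i$, let $\hat A=(\hat a_{ij})$ have rows $\hat a_i=FT(a_i)$ and columns $\hat a^j$. Let $\hat b^j=W^j\hat a^j$ for $j\le K$, with $i$-th entry $\hat b_{ij}$. The output $Y$ has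 rows $y_i=IFT\big(\hat b_{i1},\dots,\hat b_{iK},\hat a_{i,K+1},\dots,\hat a_{iN_s}\big)$. **Sequential quantum Fourier layer.** There is an upper register of $N_c$ qubits and a lower register of $N_s$ qubits. 1. Apply a loading circuit mapping $|0\rangle^{\otimes N_c}|0\rangle^{\otimes N_s}$ to $\sum_{i,j}a_{ij}|e_i\rangle|e_j\rangle$. It is assumed known that such a circuit exists with depth $O(\log N_c+N_c\log N_s)$. 2. Apply the unary $QFT$ to the lower register. 3. For $j=1,\dots,K$ successively, apply to the upper register: $P_j$; then $CU_Z$; then $P_j'$; then $CU_Z$ again. Here $U_Z$ is the product of Pauli $Z$ gates on a set of upper qubits chosen so that every $RBS$ gate of $P_j$ acts on exactly one qubit of the set, and $CU_Z$ applies $U_Z$ to the upper register if the $j$-th lower qubit is in state $|0\rangle$ and does nothing if it is in state $|1\rangle$ (implemented by at most $N_c$ controlled-$Z$ gates, plus $X$ gates on the control). 4. Apply the unary $IQFT$ to the lower register. All-to-all connectivity is assumed; depth is the number of layers when gates on disjoint qubits are executed in parallel. *)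

theory Defs
  imports
    "HOL-Analysis.Analysis"
    "HOL-Combinatorics.Permutations"
    "Jordan_Normal_Form.Schur_Decomposition"
begin

no_notation Finite_Cartesian_Product.vec_nth (infixl "$" 90)

section \<open>States and circuits\<close>

text \<open>Qubits carry labels of type \<open>'q\<close>. A computational basis state is given by the set of those
  qubits that are in state 1, and a state by its amplitudes; a register \<open>Q\<close> is a finite set of
  labels, and a state of that register vanishes outside \<open>Pow Q\<close>.\<close>

type_synonym 'q state = "'q set \<Rightarrow> complex"

definition ket :: "'q set \<Rightarrow> 'q state" where
  "ket s = (\<lambda>b. if b = s then 1 else 0)"

text \<open>\<open>Gate qs U\<close> applies the \<open>2 ^ length qs\<close>-dimensional matrix \<open>U\<close> to the qubits \<open>qs\<close>, the first
  of them being the most significant one: for two qubits the rows and columns of \<open>U\<close> are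
  indexed by 00, 01, 10, 11. \<open>Relabel \<pi>\<close> renames qubit \<open>q\<close> to \<open>\<pi> q\<close>; it is not a physical operation
  and contributes nothing to the depth.\<close>

datatype 'q op = Gate "'q list" "complex mat" | Relabel "'q \<Rightarrow> 'q"

type_synonym 'q circuit = "'q op list"

definition basis_index :: "'q list \<Rightarrow> 'q set \<Rightarrow> nat" where
  "basis_index qs b = foldl (\<lambda>k q. 2 * k + of_bool (q \<in> b)) 0 qs"

fun apply_op :: "'q op \<Rightarrow> 'q state \<Rightarrow> 'q state" where
  "apply_op (Gate qs U) \<psi> =
     (\<lambda>b. \<Sum>c\<in>Pow (set qs). U $$ (basis_index qs b, basis_index qs c) * \<psi> ((b - set qs) \<union> c))"
| "apply_op (Relabel \<pi>) \<psi> = (\<lambda>b. \<psi> (\<pi> -` b))"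

definition run :: "'q circuit \<Rightarrow> 'q state \<Rightarrow> 'q state" where
  "run C = fold apply_op C"

fun valid_op :: "'q set \<Rightarrow> 'q op \<Rightarrow> bool" where
  "valid_op Q (Gate qs U) \<longleftrightarrow>
     distinct qs \<and> length qs \<in> {1, 2} \<and> set qs \<subseteq> Q \<and>
     U \<in> carrier_mat (2 ^ length qs) (2 ^ length qs) \<and>
     U * mat_adjoint U = 1\<^sub>m (2 ^ length qs)"
| "valid_op Q (Relabel \<pi>) \<longleftrightarrow> \<pi> permutes Q"

fun is_gate :: "'q op \<Rightarrow> bool" where
  "is_gate (Gate qs U) \<longleftrightarrow> True"
| "is_gate (Relabel \<pi>) \<longleftrightarrow> False"

definition circuit_on :: "'q set \<Rightarrow> 'q circuit \<Rightarrow> bool" where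
  "circuit_on Q C \<longleftrightarrow> (\<forall>g\<in>set C. valid_op Q g)"

definition gate_circuit_on :: "'q set \<Rightarrow> 'q circuit \<Rightarrow> bool" where
  "gate_circuit_on Q C \<longleftrightarrow> circuit_on Q C \<and> (\<forall>g\<in>set C. is_gate g)"

fun inverse_op :: "'q op \<Rightarrow> 'q op" where
  "inverse_op (Gate qs U) = Gate qs (mat_adjoint U)"
| "inverse_op (Relabel \<pi>) = Relabel (inv_into UNIV \<pi>)"

definition inverse_circuit :: "'q circuit \<Rightarrow> 'q circuit" where
  "inverse_circuit C = rev (map inverse_op C)"

text \<open>The circuit \<open>C\<close> acting on the qubits \<open>f q\<close>, for injective \<open>f\<close>.\<close>

fun embed_op :: "('p \<Rightarrow> 'q) \<Rightarrow> 'p op \<Rightarrow> 'q op" where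
  "embed_op f (Gate qs U) = Gate (map f qs) U"
| "embed_op f (Relabel \<pi>) = Relabel (\<lambda>q. if q \<in> range f then f (\<pi> (inv_into UNIV f q)) else q)"

definition embed :: "('p \<Rightarrow> 'q) \<Rightarrow> 'p circuit \<Rightarrow> 'q circuit" where
  "embed f C = map (embed_op f) C"

text \<open>Each gate is executed in the first layer after all earlier gates on its qubits. \<open>t q\<close> is the
  layer of the latest gate on qubit \<open>q\<close> so far.\<close>

fun schedule_op :: "'q op \<Rightarrow> ('q \<Rightarrow> nat) \<Rightarrow> ('q \<Rightarrow> nat)" where
  "schedule_op (Gate qs U) t = (\<lambda>q. if q \<in> set qs then Suc (Max (t ` set qs)) else t q)"
| "schedule_op (Relabel \<pi>) t = (\<lambda>q. t (inv_into UNIV \<pi> q))"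

definition depth :: "'q circuit \<Rightarrow> nat" where
  "depth C = Max (range (fold schedule_op C (\<lambda>_. 0)))"

section \<open>Gates and butterfly circuits\<close>

definition X_gate :: "'q \<Rightarrow> 'q op" where
  "X_gate q = Gate [q] (mat_of_rows_list 2 [[0, 1], [1, 0]])"

definition CZ_gate :: "'q \<Rightarrow> 'q \<Rightarrow> 'q op" where
  "CZ_gate p q = Gate [p, q] (mat_of_rows_list 4
     [[1, 0, 0, 0], [0, 1, 0, 0], [0, 0, 1, 0], [0, 0, 0, -1]])"

definition RBS_gate :: "real \<Rightarrow> 'q \<Rightarrow> 'q \<Rightarrow> 'q op" where
  "RBS_gate \<theta> p q = Gate [p, q] (mat_of_rows_list 4
     [[1, 0, 0, 0],
      [0, complex_of_real (cos \<theta>), complex_of_real (sin \<theta>), 0],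
      [0, complex_of_real (- sin \<theta>), complex_of_real (cos \<theta>), 0],
      [0, 0, 0, 1]])"

definition butterfly_layer :: "nat \<Rightarrow> nat \<Rightarrow> (nat \<Rightarrow> real) \<Rightarrow> nat circuit" where
  "butterfly_layer a k \<theta> =
     map (\<lambda>p. RBS_gate (\<theta> p) p (flip_bit k p)) (filter (\<lambda>p. \<not> bit p k) [0..<2 ^ a])"

text \<open>Both orders of the bit positions that occur in the FFT are admitted (decimation in time
  and decimation in frequency).\<close>

definition butterfly :: "nat \<Rightarrow> nat circuit \<Rightarrow> bool" where
  "butterfly a P \<longleftrightarrow> (\<exists>ks \<theta>. (ks = [0..<a] \<or> ks = rev [0..<a]) \<and>
     P = concat (map (\<lambda>k. butterfly_layer a k (\<theta> k)) ks))"

text \<open>The matrix of a circuit of RBS gates restricted to the unary basis. The amplitudes of such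
  circuits between unary states are real.\<close>

definition unary_matrix :: "nat \<Rightarrow> nat circuit \<Rightarrow> real mat" where
  "unary_matrix N P = mat N N (\<lambda>(i, k). Re (run P (ket {k}) {i}))"

section \<open>Fourier transforms\<close>

text \<open>Indices start at 0.\<close>

definition FT :: "complex vec \<Rightarrow> complex vec" where
  "FT x = (let M = dim_vec x in
     vec M (\<lambda>k. 1 / complex_of_real (sqrt (real M)) *
       (\<Sum>j<M. exp (2 * of_real pi * \<i> / of_nat M) ^ (j * k) * x $ j)))"

definition IFT :: "complex vec \<Rightarrow> complex vec" where
  "IFT y = inv_into (carrier_vec (dim_vec y)) FT y"

definition unary_state :: "complex vec \<Rightarrow> nat state" where
  "unary_state x = (\<lambda>b. \<Sum>j<dim_vec x. x $ j * ket {j} b)"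

definition unary_QFT :: "nat \<Rightarrow> nat circuit \<Rightarrow> bool" where
  "unary_QFT M F \<longleftrightarrow>
     (\<exists>\<pi> G. F = Relabel \<pi> # G \<and> \<pi> permutes {..<M} \<and> gate_circuit_on {..<M} G) \<and>
     (\<forall>x\<in>carrier_vec M. run F (unary_state x) = unary_state (FT x))"

definition classical_fourier_layer :: "nat \<Rightarrow> (nat \<Rightarrow> real mat) \<Rightarrow> real mat \<Rightarrow> complex mat" where
  "classical_fourier_layer K W A =
     (let Nc = dim_row A; Ns = dim_col A;
          Ahat = mat_of_rows Ns (map (\<lambda>i. FT (map_vec complex_of_real (row A i))) [0..<Nc]);
          bhat = (\<lambda>j. map_mat complex_of_real (W j) *\<^sub>v col Ahat j)
      in mat_of_rows Ns
           (map (\<lambda>i. IFT (vec Ns (\<lambda>j. if j < K then bhat j $ i else Ahat $$ (i, j)))) [0..<Nc]))"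

section \<open>The sequential quantum Fourier layer\<close>

text \<open>The upper qubits are \<open>Inl i\<close>, the lower qubits are \<open>Inr j\<close>.\<close>

definition registers :: "nat \<Rightarrow> nat \<Rightarrow> (nat + nat) set" where
  "registers Nc Ns = {..<Nc} <+> {..<Ns}"

definition matrix_state :: "complex mat \<Rightarrow> (nat + nat) state" where
  "matrix_state Y =
     (\<lambda>b. \<Sum>i<dim_row Y. \<Sum>j<dim_col Y. Y $$ (i, j) * ket {Inl i, Inr j} b)"

definition loading_circuit :: "real mat \<Rightarrow> (nat + nat) circuit \<Rightarrow> bool" where
  "loading_circuit A L \<longleftrightarrow>
     gate_circuit_on (registers (dim_row A) (dim_col A)) L \<and>
     run L (ket {}) = matrix_state (map_mat complex_of_real A)"

definition separating_set :: "nat set \<Rightarrow> nat circuit \<Rightarrow> bool" where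
  "separating_set S P \<longleftrightarrow> (\<forall>qs U. Gate qs U \<in> set P \<longrightarrow> card (set qs \<inter> S) = 1)"

definition CU_Z :: "nat \<Rightarrow> nat set \<Rightarrow> (nat + nat) circuit" where
  "CU_Z j S = [X_gate (Inr j)] @ map (\<lambda>s. CZ_gate (Inr j) (Inl s)) (sorted_list_of_set S)
     @ [X_gate (Inr j)]"

definition sequential_fourier_layer ::
  "nat \<Rightarrow> (nat + nat) circuit \<Rightarrow> nat circuit \<Rightarrow> (nat \<Rightarrow> nat circuit) \<Rightarrow> (nat \<Rightarrow> nat set)
    \<Rightarrow> (nat + nat) circuit" where
  "sequential_fourier_layer K L F P S =
     L @ embed Inr F
     @ concat (map (\<lambda>j. embed Inl (P j) @ CU_Z j (S j) @ embed Inl (rev (P j)) @ CU_Z j (S j)) [0..<K])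
     @ embed Inr (inverse_circuit F)"

text \<open>Separating sets exist: take the labels of odd parity.\<close>

lemma odd_card_bits_flip_bit:
  fixes p :: nat
  assumes "k < a"
  shows "odd (card {i. i < a \<and> bit (flip_bit k p) i}) \<longleftrightarrow> even (card {i. i < a \<and> bit p i})"
proof (cases "bit p k")
  case True
  have "{i. i < a \<and> bit p i} = insert k {i. i < a \<and> bit (flip_bit k p) i}"
    using assms True by (auto simp: bit_flip_bit_iff)
  moreover have "k \<notin> {i. i < a \<and> bit (flip_bit k p) i}"
    using True by (auto simp: bit_flip_bit_iff)
  ultimately show ?thesis by simp
next
  case False
  have "{i. i < a \<and> bit (flip_bit k p) i} = insert k {i. i < a \<and> bit p i}"
    using assms False by (auto simp: bit_flip_bit_iff)
  then show ?thesis using False by simp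
qed

lemma flip_bit_less:
  fixes p :: nat
  assumes "k < a" "p < 2 ^ a"
  shows "flip_bit k p < 2 ^ a"
proof -
  have "take_bit a (flip_bit k p) = flip_bit k p"
    using assms by (simp add: take_bit_flip_bit_eq take_bit_nat_eq_self)
  then show ?thesis by (metis take_bit_nat_less_exp)
qed

lemma separating_set_exists:
  assumes "butterfly a P"
  shows "\<exists>S\<subseteq>{..<2 ^ a}. separating_set S P"
proof (intro exI conjI)
  let ?S = "{q. q < 2 ^ a \<and> odd (card {i. i < a \<and> bit q i})}"
  show "?S \<subseteq> {..<2 ^ a}" by auto
  show "separating_set ?S P"
    unfolding separating_set_def
  proof (intro allI impI)
    fix qs U assume "Gate qs U \<in> set P"
    then obtain k p where k: "k < a" and p: "p < 2 ^ a" and qs: "qs = [p, flip_bit k p]"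
      using assms by (auto simp: butterfly_def butterfly_layer_def RBS_gate_def)
    show "card (set qs \<inter> ?S) = 1"
    proof (cases "odd (card {i. i < a \<and> bit p i})")
      case True
      then have "set qs \<inter> ?S = {p}"
        using odd_card_bits_flip_bit[OF k, of p] p by (auto simp: qs)
      then show ?thesis by simp
    next
      case False
      then have "set qs \<inter> ?S = {flip_bit k p}"
        using odd_card_bits_flip_bit[OF k, of p] flip_bit_less[OF k p] by (auto simp: qs)
      then show ?thesis by simp
    qed
  qed
qed

end

theory Submission
  imports Defs
begin

text \<open>Fixing the basis state of one register turns a circuit embedded in the other register into the
  original circuit acting on a slice. The Fourier transforms therefore act on the rows of the
  amplitude matrix. The \<open>j\<close>-th block acts on its columns: in column \<open>j\<close> the control qubit is 1, so
  \<open>P' P\<close> is applied; in every other column it is 0 and \<open>U\<^sub>Z P' U\<^sub>Z P\<close> is the identity, because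
  conjugation with \<open>U\<^sub>Z\<close> negates every angle and \<open>P'\<close> runs the gates in reversed order. Each block has depth \<open>O(N\<^sub>c)\<close>, dominated by the controlled Z gates; the
  depth of the inverse transform equals that of the transform because a longest chain of gates can
  be read backwards.\<close>

section \<open>States\<close>

lemma run_Nil [simp]: "run [] \<psi> = \<psi>"
  by (simp add: run_def)

lemma run_Cons [simp]: "run (g # C) \<psi> = run C (apply_op g \<psi>)"
  by (simp add: run_def)

lemma run_append: "run (C @ D) \<psi> = run D (run C \<psi>)"
  by (simp add: run_def)

text \<open>Exchanging two sums gives linearity, in the form in which unary and matrix states are
  defined. The empty family covers the zero state.\<close>

lemma apply_op_sum:
  "apply_op g (\<lambda>b. \<Sum>k\<in>J. c k * \<phi> k b) = (\<lambda>b. \<Sum>k\<in>J. c k * apply_op g (\<phi> k) b)"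
proof (cases g)
  case (Gate qs U)
  then show ?thesis
    by (auto simp: fun_eq_iff sum_distrib_left mult.left_commute intro: sum.swap)
qed simp

lemma run_sum:
  "run C (\<lambda>b. \<Sum>k\<in>J. c k * \<phi> k b) = (\<lambda>b. \<Sum>k\<in>J. c k * run C (\<phi> k) b)"
  by (induction C arbitrary: \<phi>) (simp_all add: apply_op_sum)

lemma run_zero: "run C (\<lambda>_. 0) = (\<lambda>_. 0)"
  using run_sum[where J = "{}"] by simp

lemma unary_state_singleton:
  "unary_state x {i} = (if i < dim_vec x then x $ i else 0)"
proof -
  have "unary_state x {i} = (\<Sum>j<dim_vec x. if j = i then x $ j else 0)"
    unfolding unary_state_def ket_def by (intro sum.cong) auto
  then show ?thesis by simp
qed

lemma unary_state_eq_0: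
  assumes "\<And>i. i < dim_vec x \<Longrightarrow> b \<noteq> {i}"
  shows "unary_state x b = 0"
  unfolding unary_state_def ket_def using assms by (intro sum.neutral) auto

lemma matrix_state_pair:
  "matrix_state Y {Inl i, Inr j} = (if i < dim_row Y \<and> j < dim_col Y then Y $$ (i, j) else 0)"
proof -
  have "matrix_state Y {Inl i, Inr j} =
      (\<Sum>i'<dim_row Y. if i' = i then (\<Sum>j'<dim_col Y. if j' = j then Y $$ (i', j') else 0) else 0)"
    unfolding matrix_state_def ket_def
    by (intro sum.cong) (auto simp: doubleton_eq_iff if_distrib cong: if_cong)
  then show ?thesis by simp
qed

lemma matrix_state_eq_0:
  assumes "\<And>i j. i < dim_row Y \<Longrightarrow> j < dim_col Y \<Longrightarrow> b \<noteq> {Inl i, Inr j}"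
  shows "matrix_state Y b = 0"
  unfolding matrix_state_def ket_def using assms by (intro sum.neutral ballI) auto

text \<open>The qubits outside the range of \<open>f\<close> are fixed to the basis state \<open>B\<close>.\<close>

definition slice :: "('p \<Rightarrow> 'q) \<Rightarrow> 'q set \<Rightarrow> 'q state \<Rightarrow> 'p state" where
  "slice f B \<psi> = (\<lambda>c. \<psi> (B \<union> f ` c))"

text \<open>A basis state splits into its part outside \<open>range f\<close> and the image of its
  preimage under \<open>f\<close>, so the slices together contain every amplitude.\<close>

lemma eq_if_slices_eq:
  assumes "\<And>B. B \<inter> range f = {} \<Longrightarrow> slice f B \<psi> = slice f B \<phi>"
  shows "\<psi> = \<phi>"
proof
  fix b
  have "b = (b - range f) \<union> f ` (f -` b)" by auto
  moreover have "slice f (b - range f) \<psi> (f -` b) = slice f (b - range f) \<phi> (f -` b)"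
    using assms by (metis Diff_disjoint Int_commute)
  ultimately show "\<psi> b = \<phi> b" by (simp add: slice_def)
qed

text \<open>Basis states in the support have exactly one upper qubit set, so only slices at some
  \<open>{Inl i}\<close> survive. The zero slices are recorded too, since equality of states
  requires agreement for every \<open>B\<close>.\<close>

lemma slice_row:
  assumes "B \<inter> range Inr = {}"
  shows "slice Inr B (matrix_state Y) =
    (if \<exists>i<dim_row Y. B = {Inl i} then unary_state (row Y (THE i. B = {Inl i})) else (\<lambda>_. 0))"
proof (cases "\<exists>i<dim_row Y. B = {Inl i}")
  case True
  then obtain i where i: "i < dim_row Y" "B = {Inl i}" by auto
  have "matrix_state Y (insert (Inl i) (Inr ` c)) = unary_state (row Y i) c" for c
  proof (cases "\<exists>j<dim_col Y. c = {j}")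
    case True
    then show ?thesis using i by (auto simp: matrix_state_pair unary_state_singleton)
  next
    case False
    have "insert (Inl i) (Inr ` c) \<noteq> {Inl i', Inr j}" if "j < dim_col Y" for i' j
    proof
      assume "insert (Inl i) (Inr ` c) = {Inl i', Inr j}"
      then have "Inr -` insert (Inl i) (Inr ` c) = Inr -` {Inl i', Inr j}" by simp
      then have "c = {j}" by auto
      then show False using False that by auto
    qed
    then have "matrix_state Y (insert (Inl i) (Inr ` c)) = 0" by (intro matrix_state_eq_0)
    moreover have "unary_state (row Y i) c = 0" using False by (intro unary_state_eq_0) auto
    ultimately show ?thesis by simp
  qed
  then show ?thesis using i by (simp add: slice_def fun_eq_iff)
next
  case False
  have "B \<union> Inr ` c \<noteq> {Inl i, Inr j}" if "i < dim_row Y" for c i j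
  proof
    assume *: "B \<union> Inr ` c = {Inl i, Inr j}"
    have "B = (B \<union> Inr ` c) - range Inr" using assms by auto
    also have "\<dots> = {Inl i}" unfolding * by auto
    finally show False using False that by auto
  qed
  then show ?thesis unfolding if_not_P[OF False]
    by (auto simp: slice_def fun_eq_iff intro: matrix_state_eq_0)
qed

lemma slice_col:
  assumes "B \<inter> range Inl = {}"
  shows "slice Inl B (matrix_state Y) =
    (if \<exists>j<dim_col Y. B = {Inr j} then unary_state (col Y (THE j. B = {Inr j})) else (\<lambda>_. 0))"
proof (cases "\<exists>j<dim_col Y. B = {Inr j}")
  case True
  then obtain j where j: "j < dim_col Y" "B = {Inr j}" by auto
  have "matrix_state Y (insert (Inr j) (Inl ` c)) = unary_state (col Y j) c" for c
  proof (cases "\<exists>i<dim_row Y. c = {i}")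
    case True
    then show ?thesis using j
      by (auto simp: matrix_state_pair unary_state_singleton insert_commute[of "Inr _"])
  next
    case False
    have "insert (Inr j) (Inl ` c) \<noteq> {Inl i, Inr j'}" if "i < dim_row Y" for i j'
    proof
      assume "insert (Inr j) (Inl ` c) = {Inl i, Inr j'}"
      then have "Inl -` insert (Inr j) (Inl ` c) = Inl -` {Inl i, Inr j'}" by simp
      then have "c = {i}" by auto
      then show False using False that by auto
    qed
    then have "matrix_state Y (insert (Inr j) (Inl ` c)) = 0" by (intro matrix_state_eq_0)
    moreover have "unary_state (col Y j) c = 0" using False by (intro unary_state_eq_0) auto
    ultimately show ?thesis by simp
  qed
  then show ?thesis using j by (simp add: slice_def fun_eq_iff)
next
  case False
  have "B \<union> Inl ` c \<noteq> {Inl i, Inr j}" if "j < dim_col Y" for c i j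
  proof
    assume *: "B \<union> Inl ` c = {Inl i, Inr j}"
    have "B = (B \<union> Inl ` c) - range Inl" using assms by auto
    also have "\<dots> = {Inr j}" unfolding * by auto
    finally show False using False that by auto
  qed
  then show ?thesis unfolding if_not_P[OF False]
    by (auto simp: slice_def fun_eq_iff intro: matrix_state_eq_0)
qed

section \<open>Indices of basis states and embedded circuits\<close>

lemma basis_index_Nil [simp]: "basis_index [] b = 0"
  by (simp add: basis_index_def)

lemma basis_index_snoc [simp]:
  "basis_index (qs @ [q]) b = 2 * basis_index qs b + of_bool (q \<in> b)"
  by (simp add: basis_index_def)

lemma basis_index_less: "basis_index qs b < 2 ^ length qs"
  by (induction qs rule: rev_induct) auto

lemma basis_index_cong:
  "(\<And>q. q \<in> set qs \<Longrightarrow> q \<in> b \<longleftrightarrow> q \<in> c) \<Longrightarrow> basis_index qs b = basis_index qs c"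
  by (induction qs rule: rev_induct) auto

lemma basis_index_eqD:
  "basis_index qs b = basis_index qs c \<Longrightarrow> q \<in> set qs \<Longrightarrow> q \<in> b \<longleftrightarrow> q \<in> c"
proof (induction qs rule: rev_induct)
  case (snoc r qs)
  \<comment> \<open>The last qubit is the parity of the index, and the preceding ones determine its
    half.\<close>
  have "basis_index qs b = basis_index qs c \<and> (r \<in> b \<longleftrightarrow> r \<in> c)"
    using snoc.prems(1) by (cases "r \<in> b"; cases "r \<in> c"; simp; presburger)
  then show ?case using snoc by auto
qed simp

text \<open>Injectivity and equal cardinality suffice. The bijection turns sums over matrix indices
  into sums over subsets of the qubits of a gate.\<close>

lemma bij_betw_basis_index:
  assumes "distinct qs"
  shows "bij_betw (basis_index qs) (Pow (set qs)) {..<2 ^ length qs}"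
proof -
  have inj: "inj_on (basis_index qs) (Pow (set qs))"
    by (rule inj_onI) (blast dest: basis_index_eqD)
  have "basis_index qs ` Pow (set qs) = {..<2 ^ length qs}"
    using inj assms
    by (intro card_subset_eq) (auto simp: basis_index_less card_image card_Pow distinct_card)
  then show ?thesis using inj by (simp add: bij_betw_def)
qed

lemma basis_index_map:
  "inj f \<Longrightarrow> basis_index (map f qs) b = basis_index qs (f -` b)"
  by (induction qs rule: rev_induct) auto

text \<open>An embedded operation reads and changes only qubits in \<open>range f\<close>; the bits
  in \<open>B\<close> lie outside and stay as they are.\<close>

lemma slice_apply_embed_op:
  assumes "inj f" "B \<inter> range f = {}"
  shows "slice f B (apply_op (embed_op f g) \<psi>) = apply_op g (slice f B \<psi>)"
proof (cases g)
  case (Gate qs U)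
  have v: "f -` B = {}" using assms(2) by auto
  have *: "B \<union> f ` c - f ` set qs \<union> f ` d = B \<union> f ` (c - set qs \<union> d)" for c d
    using assms by (auto simp: inj_image_mem_iff image_Un image_set_diff)
  have inj: "inj_on ((`) f) (Pow (set qs))"
    using assms(1) by (intro inj_onI) (simp add: inj_image_eq_iff)
  have vd: "f -` (f ` d) = d" for d using assms(1) by (rule inj_vimage_image_eq)
  show ?thesis
    unfolding Gate slice_def fun_eq_iff
    by (simp add: sum.reindex[OF inj] basis_index_map assms(1) v vd * flip: image_Pow_surj)
next
  case (Relabel \<pi>)
  have "(\<lambda>q. if q \<in> range f then f (\<pi> (inv_into UNIV f q)) else q) -` (B \<union> f ` c) = B \<union> f ` (\<pi> -` c)"
    for c
    using assms by (auto simp: inj_image_mem_iff inj_eq[OF assms(1)] split: if_splits)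
  then show ?thesis by (simp add: slice_def Relabel)
qed

lemma slice_run_embed:
  assumes "inj f" "B \<inter> range f = {}"
  shows "slice f B (run (embed f C) \<psi>) = run C (slice f B \<psi>)"
  by (induction C arbitrary: \<psi>) (simp_all add: embed_def slice_apply_embed_op assms)

text \<open>For a fixed upper basis state the slice is a row or zero: rows evolve by
  \<open>C\<close> alone, and zero stays zero by linearity.\<close>

lemma run_embed_rows:
  assumes "dim_row Y = dim_row X" "dim_col Y = dim_col X"
    and "\<And>i. i < dim_row X \<Longrightarrow> run C (unary_state (row X i)) = unary_state (row Y i)"
  shows "run (embed Inr C) (matrix_state X) = matrix_state Y"
proof (rule eq_if_slices_eq)
  fix B :: "(nat + nat) set"
  assume B: "B \<inter> range Inr = {}"
  show "slice Inr B (run (embed Inr C) (matrix_state X)) = slice Inr B (matrix_state Y)"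
    using B assms by (auto simp: slice_run_embed slice_row run_zero)
qed

section \<open>Inverse circuits\<close>

lemma mat_adjoint_carrier:
  "U \<in> carrier_mat r c \<Longrightarrow> mat_adjoint U \<in> carrier_mat c r"
  by (auto simp: mat_adjoint_def)

lemma dim_mat_adjoint [simp]:
  "dim_row (mat_adjoint U) = dim_col U" "dim_col (mat_adjoint U) = dim_row U"
  by (simp_all add: mat_adjoint_def)

lemma index_mat_adjoint:
  fixes U :: "complex mat"
  assumes "i < dim_col U" "j < dim_row U"
  shows "mat_adjoint U $$ (i, j) = cnj (U $$ (j, i))"
  using assms by (simp add: mat_adjoint_def mat_of_rows_index conjugate_complex_def)

lemma mat_adjoint_adjoint:
  fixes U :: "complex mat"
  shows "mat_adjoint (mat_adjoint U) = U"
  by (intro eq_matI) (simp_all add: index_mat_adjoint)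

text \<open>For square matrices a right inverse is a left inverse. Validity of a gate gives the
  adjoint as right inverse, while undoing the gate takes it as left inverse.\<close>

lemma mat_adjoint_mult_left:
  fixes U :: "complex mat"
  assumes "U \<in> carrier_mat n n" "U * mat_adjoint U = 1\<^sub>m n"
  shows "mat_adjoint U * U = 1\<^sub>m n"
  using assms mat_adjoint_carrier mat_mult_left_right_inverse by blast

lemma valid_inverse_op:
  "valid_op Q g \<Longrightarrow> valid_op Q (inverse_op g)"
  by (cases g) (auto simp: mat_adjoint_carrier mat_adjoint_adjoint mat_adjoint_mult_left permutes_inv)

text \<open>The two gates compose to a matrix product, summed over subsets of the qubits of the
  gate. The product is the identity, so only the summand restoring the bits of \<open>b\<close> on
  these qubits is left.\<close>

lemma apply_inverse_op:
  assumes "valid_op Q g"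
  shows "apply_op (inverse_op g) (apply_op g \<psi>) = \<psi>"
proof (cases g)
  case (Gate qs U)
  let ?n = "2 ^ length qs :: nat"
  let ?I = "basis_index qs"
  have U: "U \<in> carrier_mat ?n ?n" "mat_adjoint U * U = 1\<^sub>m ?n" and qs: "distinct qs"
    using assms Gate mat_adjoint_mult_left[of U ?n] by auto
  have UU: "(\<Sum>c\<in>Pow (set qs). mat_adjoint U $$ (?I b, ?I c) * U $$ (?I c, ?I d)) =
      of_bool (?I b = ?I d)" for b d
  proof -
    have "of_bool (?I b = ?I d) = (mat_adjoint U * U) $$ (?I b, ?I d)"
      by (simp add: U basis_index_less)
    also have "\<dots> = (\<Sum>k<?n. mat_adjoint U $$ (?I b, k) * U $$ (k, ?I d))"
      using U(1) mat_adjoint_carrier[OF U(1)]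
      by (simp add: scalar_prod_def basis_index_less atLeast0LessThan)
    also have "\<dots> = (\<Sum>c\<in>Pow (set qs). mat_adjoint U $$ (?I b, ?I c) * U $$ (?I c, ?I d))"
      by (rule sum.reindex_bij_betw[OF bij_betw_basis_index[OF qs], symmetric])
    finally show ?thesis by simp
  qed
  show ?thesis
  proof
    fix b
    have I: "?I (b - set qs \<union> c) = ?I c" for c
      by (rule basis_index_cong) auto
    have s: "(b - set qs \<union> c) - set qs \<union> d = b - set qs \<union> d" if "c \<subseteq> set qs" for c d
      using that by auto
    have "apply_op (inverse_op g) (apply_op g \<psi>) b =
        (\<Sum>c\<in>Pow (set qs). \<Sum>d\<in>Pow (set qs).
          mat_adjoint U $$ (?I b, ?I c) * (U $$ (?I c, ?I d) * \<psi> (b - set qs \<union> d)))"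
      unfolding Gate by (simp add: sum_distrib_left I s)
    also have "\<dots> = (\<Sum>d\<in>Pow (set qs).
        (\<Sum>c\<in>Pow (set qs). mat_adjoint U $$ (?I b, ?I c) * U $$ (?I c, ?I d)) *
          \<psi> (b - set qs \<union> d))"
      by (subst sum.swap) (simp add: sum_distrib_right mult.assoc)
    also have "\<dots> = (\<Sum>d\<in>Pow (set qs). if d = b \<inter> set qs then \<psi> (b - set qs \<union> d) else 0)"
    proof (intro sum.cong refl)
      fix d assume "d \<in> Pow (set qs)"
      then have "?I b = ?I d \<longleftrightarrow> d = b \<inter> set qs"
        using basis_index_eqD[of qs b d] basis_index_cong[of qs b d] by blast
      then show "(\<Sum>c\<in>Pow (set qs). mat_adjoint U $$ (?I b, ?I c) * U $$ (?I c, ?I d)) *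
          \<psi> (b - set qs \<union> d) = (if d = b \<inter> set qs then \<psi> (b - set qs \<union> d) else 0)"
        by (simp add: UU)
    qed
    also have "\<dots> = \<psi> b"
      by (simp add: Un_Diff_Int Un_commute Int_commute)
    finally show "apply_op (inverse_op g) (apply_op g \<psi>) b = \<psi> b" .
  qed
next
  case (Relabel \<pi>)
  then have "bij \<pi>" using assms by (auto simp: permutes_bij)
  then have "\<pi> -` (inv_into UNIV \<pi> -` b) = b" for b
    by (auto simp: bij_is_inj)
  then show ?thesis using Relabel by simp
qed

lemma run_inverse_circuit:
  "circuit_on Q C \<Longrightarrow> run (inverse_circuit C) (run C \<psi>) = \<psi>"
  by (induction C arbitrary: \<psi>)
    (auto simp: inverse_circuit_def circuit_on_def run_append intro: apply_inverse_op)

lemma circuit_on_append: "circuit_on Q (C @ D) \<longleftrightarrow> circuit_on Q C \<and> circuit_on Q D"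
  by (auto simp: circuit_on_def)

lemma circuit_on_inverse_circuit: "circuit_on Q C \<Longrightarrow> circuit_on Q (inverse_circuit C)"
  by (auto simp: circuit_on_def inverse_circuit_def valid_inverse_op)

section \<open>Circuits placed in a larger register\<close>

text \<open>On \<open>range f\<close> the embedded relabelling is \<pi> conjugated by
  \<open>f\<close>, elsewhere the identity. The first claim serves validity; the formulas for the
  inverse serve the schedule, which pulls layer counters back along it.\<close>

lemma embed_permutation:
  assumes "inj f" "\<pi> permutes Q"
  defines "\<rho> \<equiv> \<lambda>q. if q \<in> range f then f (\<pi> (inv_into UNIV f q)) else q"
  shows "\<rho> permutes f ` Q" "inv_into UNIV \<rho> (f q) = f (inv_into UNIV \<pi> q)" "q' \<notin> range f \<Longrightarrow> inv_into UNIV \<rho> q' = q'"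
proof -
  have \<pi>: "bij \<pi>" using assms(2) by (rule permutes_bij)
  have r: "\<rho> (f q) = f (\<pi> q)" for q using assms(1) by (simp add: \<rho>_def)
  have n: "\<rho> q = q" if "q \<notin> range f" for q using that by (simp add: \<rho>_def)
  have inj: "inj \<rho>"
  proof (rule injI)
    fix x y assume *: "\<rho> x = \<rho> y"
    have "x \<in> range f \<longleftrightarrow> y \<in> range f"
      using * r n by (metis rangeE rangeI)
    then show "x = y"
      using * by (cases "x \<in> range f")
        (auto simp: r n inj_eq[OF assms(1)] inj_eq[OF bij_is_inj[OF \<pi>]])
  qed
  have fi: "\<rho> (f (inv_into UNIV \<pi> q)) = f q" for q
    using bij_is_surj[OF \<pi>] by (simp add: r surj_f_inv_f)
  show "inv_into UNIV \<rho> (f q) = f (inv_into UNIV \<pi> q)" using inj fi by (rule inv_f_eq)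
  show "inv_into UNIV \<rho> q' = q'" if "q' \<notin> range f" using inj n[OF that] by (rule inv_f_eq)
  have "\<exists>!x. \<rho> x = y" for y
  proof (rule ex_ex1I)
    show "\<exists>x. \<rho> x = y" using fi n by (cases "y \<in> range f") blast+
  qed (use inj in \<open>auto dest: injD\<close>)
  moreover have "\<rho> x = x" if "x \<notin> f ` Q" for x
  proof (cases "x \<in> range f")
    case True
    then obtain z where z: "x = f z" by blast
    then have "z \<notin> Q" using that by blast
    then show ?thesis by (simp add: z r permutes_not_in[OF assms(2)])
  qed (simp add: n)
  ultimately show "\<rho> permutes f ` Q" unfolding permutes_def by blast
qed

lemma circuit_on_embed:
  assumes "inj f" "circuit_on Q C" "f ` Q \<subseteq> R"
  shows "circuit_on R (embed f C)"
proof -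
  have "valid_op R (embed_op f g)" if "g \<in> set C" for g
  proof (cases g)
    case (Gate qs U)
    then have "valid_op Q (Gate qs U)" using that assms(2) unfolding circuit_on_def by blast
    then show ?thesis
      using inj_on_subset[OF assms(1), of "set qs"] assms(3) by (auto simp: Gate distinct_map)
  next
    case (Relabel \<pi>)
    then have "\<pi> permutes Q" using that assms(2) by (auto simp: circuit_on_def)
    then show ?thesis
      using permutes_subset[OF embed_permutation(1)[OF assms(1)] assms(3)] by (simp add: Relabel)
  qed
  then show ?thesis by (auto simp: circuit_on_def embed_def)
qed

section \<open>Depth\<close>

text \<open>\<open>depth\<close> takes a maximum over all labels, of which there may be infinitely
  many; finitely many values make this \<open>Max\<close> meaningful.\<close>

lemma finite_range_schedule:
  "finite (range t) \<Longrightarrow> finite (range (fold schedule_op C t))"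
proof (induction C arbitrary: t)
  case (Cons g C)
  have "finite (range (schedule_op g t))"
  proof (cases g)
    case (Gate qs U)
    have "range (schedule_op g t) \<subseteq> insert (Suc (Max (t ` set qs))) (range t)"
      by (auto simp: Gate)
    then show ?thesis using Cons.prems finite_subset by blast
  next
    case (Relabel \<pi>)
    have "range (schedule_op g t) \<subseteq> range t" by (auto simp: Relabel)
    then show ?thesis using Cons.prems finite_subset by blast
  qed
  then show ?case using Cons.IH by simp
qed simp

lemma depth_le_iff: "depth C \<le> d \<longleftrightarrow> (\<forall>q. fold schedule_op C (\<lambda>_. 0) q \<le> d)"
  using finite_range_schedule[of "\<lambda>_. 0" C] by (simp add: depth_def)

lemma schedule_le_depth: "fold schedule_op C (\<lambda>_. 0) q \<le> depth C"
  using depth_le_iff[of C "depth C"] by simp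

text \<open>A gate adds one to a maximum and a relabelling only moves values, so a lead of at most
  \<open>d\<close> is never enlarged.\<close>

lemma schedule_op_le:
  assumes "\<And>q. t q \<le> s q + d"
  shows "schedule_op g t q \<le> schedule_op g s q + d"
proof (cases g)
  case (Gate qs U)
  have "Max (t ` set qs) \<le> Max (s ` set qs) + d" if "q \<in> set qs"
  proof -
    have "t r \<le> Max (s ` set qs) + d" if "r \<in> set qs" for r
    proof -
      have "s r \<le> Max (s ` set qs)" using that by simp
      then show ?thesis using assms[of r] by linarith
    qed
    then show ?thesis using that by (subst Max_le_iff) auto
  qed
  then show ?thesis using assms by (simp add: Gate)
qed (simp add: assms)

lemma schedule_le:
  "(\<And>q. t q \<le> s q + d) \<Longrightarrow> fold schedule_op C t q \<le> fold schedule_op C s q + d"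
proof (induction C arbitrary: t s)
  case (Cons g C)
  then have "fold schedule_op C (schedule_op g t) q \<le> fold schedule_op C (schedule_op g s) q + d"
    by (intro Cons.IH schedule_op_le)
  then show ?case by simp
qed simp

text \<open>After \<open>C\<close> every layer counter is at most \<open>depth C\<close>, so
  \<open>D\<close> finishes at most that much later than from zero counters.\<close>

lemma depth_append: "depth (C @ D) \<le> depth C + depth D"
  unfolding depth_le_iff[of "C @ D"]
proof
  fix q
  have "fold schedule_op D (fold schedule_op C (\<lambda>_. 0)) q
      \<le> fold schedule_op D (\<lambda>_. 0) q + depth C"
    by (rule schedule_le) (simp add: schedule_le_depth)
  also have "\<dots> \<le> depth C + depth D" by (simp add: schedule_le_depth)
  finally show "fold schedule_op (C @ D) (\<lambda>_. 0) q \<le> depth C + depth D" by simp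
qed

lemma depth_Nil [simp]: "depth [] = 0"
  by (simp add: depth_def)

lemma depth_concat: "depth (concat Cs) \<le> sum_list (map depth Cs)"
proof (induction Cs)
  case (Cons C Cs)
  then show ?case using depth_append[of C "concat Cs"] by simp
qed simp

lemma depth_le_length: "depth C \<le> length C"
proof (induction C)
  case (Cons g C)
  have "depth [g] \<le> 1"
    unfolding depth_le_iff by (cases g) (auto simp: image_constant_conv)
  then show ?case using Cons depth_append[of "[g]" C] by simp
qed simp

text \<open>The counter of \<open>f q\<close> copies that of \<open>q\<close> at every stage, while
  counters outside \<open>range f\<close> remain 0.\<close>

lemma depth_embed:
  assumes "inj f" "circuit_on Q C"
  shows "depth (embed f C) \<le> depth C"
proof -
  have op: "(\<forall>q. schedule_op (embed_op f g) t' (f q) = schedule_op g t q) \<and>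
      (\<forall>q. q \<notin> range f \<longrightarrow> schedule_op (embed_op f g) t' q = 0)"
    if g: "valid_op Q g" and t: "\<And>q. t' (f q) = t q" "\<And>q. q \<notin> range f \<Longrightarrow> t' q = 0" for g t t'
  proof (cases g)
    case (Gate qs U)
    have "t' ` f ` set qs = t ` set qs" by (simp add: image_image t)
    then show ?thesis using assms(1) by (auto simp: Gate t inj_image_mem_iff)
  next
    case (Relabel \<pi>)
    then have "\<pi> permutes Q" using g by simp
    note embed_permutation(2,3)[OF assms(1) this]
    then show ?thesis by (simp add: Relabel t)
  qed
  have "(\<forall>q. fold schedule_op (embed f C) t' (f q) = fold schedule_op C t q) \<and>
      (\<forall>q. q \<notin> range f \<longrightarrow> fold schedule_op (embed f C) t' q = 0)"
    if "\<And>q. t' (f q) = t q" "\<And>q. q \<notin> range f \<Longrightarrow> t' q = 0" for t t'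
    using assms(2) that
  proof (induction C arbitrary: t t')
    case (Cons g C)
    then have C: "circuit_on Q C" and g: "valid_op Q g" by (auto simp: circuit_on_def)
    have "(\<forall>q. fold schedule_op (embed f C) (schedule_op (embed_op f g) t') (f q) =
          fold schedule_op C (schedule_op g t) q) \<and>
        (\<forall>q. q \<notin> range f \<longrightarrow>
          fold schedule_op (embed f C) (schedule_op (embed_op f g) t') q = 0)"
      by (intro Cons.IH[OF C]) (use op[OF g] Cons.prems(2,3) in blast)+
    then show ?case by (simp add: embed_def)
  qed (simp add: embed_def)
  note * = this[of "\<lambda>_. 0" "\<lambda>_. 0", simplified]
  have "fold schedule_op (embed f C) (\<lambda>_. 0) q \<le> depth C" for q
    using * schedule_le_depth[of C] by (cases "q \<in> range f") auto
  then show ?thesis by (simp add: depth_le_iff[of "embed f C"])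
qed

section \<open>Depth under reversal and inversion\<close>

text \<open>At the qubits of the gate both sides say that one plus the maxima of \<open>t\<close>
  and of \<open>s\<close> over these qubits is at most \<open>d\<close>; at all others they say
  \<open>t q + s q \<le> d\<close>.\<close>

lemma schedule_op_gate_swap:
  assumes "is_gate g"
  shows "(\<forall>q. schedule_op g t q + s q \<le> d) \<longleftrightarrow> (\<forall>q. t q + schedule_op g s q \<le> d)"
proof -
  obtain qs U where g: "g = Gate qs U" using assms by (cases g) auto
  \<comment> \<open>One direction for arbitrary \<open>s\<close> and \<open>t\<close>, using a qubit
    that attains the maximum of \<open>s\<close>; exchanging their roles gives the other.\<close>
  have half: "t q + schedule_op g s q \<le> d" if *: "\<And>q. schedule_op g t q + s q \<le> d" for s t q
  proof (cases "q \<in> set qs")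
    case True
    then have "Max (s ` set qs) \<in> s ` set qs" by (intro Max_in) auto
    then obtain r where r: "r \<in> set qs" "Max (s ` set qs) = s r" by blast
    have "t q \<le> Max (t ` set qs)" using True by simp
    moreover have "Suc (Max (t ` set qs)) + s r \<le> d" using *[of r] r(1) by (simp add: g)
    ultimately have "t q + Suc (s r) \<le> d" by linarith
    then show ?thesis using r True by (simp add: g)
  next
    case False
    then show ?thesis using *[of q] by (simp add: g)
  qed
  show ?thesis
  proof (intro iffI allI)
    fix q assume "\<forall>q. schedule_op g t q + s q \<le> d"
    then show "t q + schedule_op g s q \<le> d" by (intro half) simp
  next
    fix q assume "\<forall>q. t q + schedule_op g s q \<le> d"
    then have "s q + schedule_op g t q \<le> d" by (intro half) (simp add: add.commute)
    then show "schedule_op g t q + s q \<le> d" by (simp add: add.commute)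
  qed
qed

text \<open>Both sides say that no chain of gates continued by \<open>t\<close> before and by \<open>s\<close> after has more than
  \<open>d\<close> layers.\<close>

lemma schedule_swap:
  assumes "\<forall>g\<in>set C. is_gate g"
  shows "(\<forall>q. fold schedule_op C t q + s q \<le> d) \<longleftrightarrow> (\<forall>q. t q + fold schedule_op (rev C) s q \<le> d)"
  using assms
proof (induction C arbitrary: t)
  case (Cons g C)
  then show ?case
    using schedule_op_gate_swap[of g t "fold schedule_op (rev C) s" d] by simp
qed simp

text \<open>With both end functions zero, \<open>schedule_swap\<close> shows that the two depths
  have the same upper bounds.\<close>

lemma depth_rev:
  assumes "\<forall>g\<in>set C. is_gate g"
  shows "depth (rev C) = depth C"
proof -
  have "depth (rev C) \<le> d \<longleftrightarrow> depth C \<le> d" for d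
    using schedule_swap[OF assms, of "\<lambda>_. 0" "\<lambda>_. 0" d] by (simp add: depth_le_iff)
  then show ?thesis by (intro order_antisym) blast+
qed

text \<open>Adjoint gates act on the same qubits, so reversal invariance applies to
  \<open>G\<close>. The relabelling comes first in the circuit, where all counters are 0, and last
  in the inverse, where it merely moves final counters.\<close>

lemma depth_inverse_circuit:
  assumes "\<forall>g\<in>set G. is_gate g"
  shows "depth (inverse_circuit (Relabel \<pi> # G)) \<le> depth (Relabel \<pi> # G)"
proof -
  have op: "schedule_op (inverse_op g) = schedule_op g \<and> is_gate (inverse_op g)" if "g \<in> set G" for g
    using that assms by (cases g rule: op.exhaust) (auto simp: fun_eq_iff)
  have "fold schedule_op (map inverse_op G) t = fold schedule_op G t" for t
    using op by (induction G arbitrary: t) auto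
  then have "depth (map inverse_op G) = depth G" by (simp add: depth_def)
  moreover have "depth (rev (map inverse_op G)) = depth (map inverse_op G)"
    using op by (intro depth_rev) auto
  moreover have "depth (rev (map inverse_op G) @ [Relabel \<rho>]) \<le> depth (rev (map inverse_op G))"
    for \<rho> :: "'a \<Rightarrow> 'a"
    unfolding depth_le_iff[of "_ @ _"] by (simp add: schedule_le_depth)
  moreover have "depth (Relabel \<pi> # G) = depth G" by (simp add: depth_def)
  ultimately show ?thesis by (simp add: inverse_circuit_def)
qed

text \<open>By induction from the right, the counter is 1 on the qubits touched so far and 0
  elsewhere; disjointness makes the next gate start from zero counters.\<close>

lemma depth_disjoint_gates:
  assumes "distinct ps"
    and "\<And>p p'. p \<in> set ps \<Longrightarrow> p' \<in> set ps \<Longrightarrow> p \<noteq> p' \<Longrightarrow> set (qs p) \<inter> set (qs p') = {}"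
  shows "depth (map (\<lambda>p. Gate (qs p) (U p)) ps) \<le> 1"
proof -
  have "fold schedule_op (map (\<lambda>p. Gate (qs p) (U p)) ps) (\<lambda>_. 0) =
      (\<lambda>q. if q \<in> (\<Union>p\<in>set ps. set (qs p)) then 1 else 0)"
    using assms
  proof (induction ps rule: rev_induct)
    case (snoc p ps)
    let ?t = "\<lambda>q. if q \<in> (\<Union>p\<in>set ps. set (qs p)) then 1 else 0 :: nat"
    have "?t q = 0" if "q \<in> set (qs p)" for q
      using snoc.prems(1) snoc.prems(2)[of p] that by fastforce
    then have "Max (?t ` set (qs p)) = 0" if "q \<in> set (qs p)" for q
      using that by (intro Max_eqI) force+
    moreover have "fold schedule_op (map (\<lambda>p. Gate (qs p) (U p)) ps) (\<lambda>_. 0) = ?t"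
      using snoc.prems by (intro snoc.IH) auto
    ultimately show ?case by (auto simp: fun_eq_iff)
  qed simp
  then show ?thesis by (simp add: depth_le_iff)
qed

section \<open>RBS circuits on the unary basis\<close>

lemma basis_index_single: "basis_index [p] b = of_bool (p \<in> b)"
  by (simp add: basis_index_def)

lemma basis_index_pair: "basis_index [p, q] b = 2 * of_bool (p \<in> b) + of_bool (q \<in> b)"
  by (simp add: basis_index_def)

lemma sum_Pow_single: "(\<Sum>c\<in>Pow {p}. h c) = h {} + h {p}"
  by (simp add: Pow_insert add.commute)

lemma sum_Pow_pair:
  assumes "p \<noteq> q"
  shows "(\<Sum>c\<in>Pow {p, q}. h c) = h {} + h {p} + h {q} + h {p, q}"
proof -
  have "Pow {p, q} = {{}, {p}, {q}, {p, q}}" by auto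
  then show ?thesis using assms by (simp add: doubleton_eq_iff add.assoc)
qed

lemma apply_X_gate:
  "apply_op (X_gate q) \<psi> b = \<psi> (if q \<in> b then b - {q} else insert q b)"
  by (simp add: X_gate_def sum_Pow_single basis_index_single mat_of_rows_list_def)

lemma apply_CZ_gate:
  assumes "p \<noteq> q"
  shows "apply_op (CZ_gate p q) \<psi> b = (if p \<in> b \<and> q \<in> b then - 1 else 1) * \<psi> b"
proof -
  have s: "p \<in> b \<Longrightarrow> q \<in> b \<Longrightarrow> insert p (insert q (b - {p, q})) = b"
    "p \<in> b \<Longrightarrow> q \<notin> b \<Longrightarrow> insert p (b - {p, q}) = b"
    "p \<notin> b \<Longrightarrow> q \<in> b \<Longrightarrow> insert q (b - {p, q}) = b"
    "p \<notin> b \<Longrightarrow> q \<notin> b \<Longrightarrow> b - {p, q} = b" by auto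
  show ?thesis
    using assms s
    by (cases "p \<in> b"; cases "q \<in> b")
      (simp_all add: CZ_gate_def sum_Pow_pair basis_index_pair mat_of_rows_list_def)
qed

text \<open>An amplitude collects the contributions of the basis states mapped to it, so
  \<open>b\<close> with only \<open>q\<close> set reads row 01 of the matrix, where the sine is
  positive.\<close>

lemma apply_RBS_gate:
  assumes "p \<noteq> q"
  shows "apply_op (RBS_gate \<theta> p q) \<psi> b =
    (if p \<in> b \<longleftrightarrow> q \<in> b then \<psi> b
     else if q \<in> b
     then complex_of_real (cos \<theta>) * \<psi> b + complex_of_real (sin \<theta>) * \<psi> (insert p (b - {q}))
     else complex_of_real (cos \<theta>) * \<psi> b - complex_of_real (sin \<theta>) * \<psi> (insert q (b - {p})))"
proof -
  have s: "p \<in> b \<Longrightarrow> q \<in> b \<Longrightarrow> insert p (insert q (b - {p, q})) = b"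
    "p \<in> b \<Longrightarrow> q \<notin> b \<Longrightarrow> insert p (b - {p, q}) = b"
    "p \<in> b \<Longrightarrow> q \<notin> b \<Longrightarrow> insert q (b - {p, q}) = insert q (b - {p})"
    "p \<notin> b \<Longrightarrow> q \<in> b \<Longrightarrow> insert q (b - {p, q}) = b"
    "p \<notin> b \<Longrightarrow> q \<in> b \<Longrightarrow> insert p (b - {p, q}) = insert p (b - {q})"
    "p \<notin> b \<Longrightarrow> q \<notin> b \<Longrightarrow> b - {p, q} = b" by auto
  show ?thesis
    using assms s
    by (cases "p \<in> b"; cases "q \<in> b")
      (simp_all add: RBS_gate_def sum_Pow_pair basis_index_pair mat_of_rows_list_def)
qed

lemma less_4_cases: "i < 4 \<longleftrightarrow> i = 0 \<or> i = 1 \<or> i = 2 \<or> i = (3::nat)"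
  by auto

lemma sum_4: "(\<Sum>k = 0..<4. h k) = h 0 + h 1 + h 2 + h (3::nat)"
  by (simp add: numeral_eq_Suc)

lemma valid_X_gate: "q \<in> Q \<Longrightarrow> valid_op Q (X_gate q)"
  by (auto simp: X_gate_def mat_of_rows_list_def index_mat_adjoint scalar_prod_def
      less_Suc_eq numeral_2_eq_2 intro!: eq_matI)

lemma valid_CZ_gate: "p \<in> Q \<Longrightarrow> q \<in> Q \<Longrightarrow> p \<noteq> q \<Longrightarrow> valid_op Q (CZ_gate p q)"
  by (auto simp: CZ_gate_def mat_of_rows_list_def index_mat_adjoint scalar_prod_def sum_4
      less_4_cases intro!: eq_matI)

lemma valid_RBS_gate:
  assumes "p \<in> Q" "q \<in> Q" "p \<noteq> q"
  shows "valid_op Q (RBS_gate \<theta> p q)"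
proof -
  have cs: "complex_of_real (cos \<theta>) * complex_of_real (cos \<theta>) +
      complex_of_real (sin \<theta>) * complex_of_real (sin \<theta>) = 1"
    unfolding of_real_mult[symmetric] of_real_add[symmetric]
    using sin_cos_squared_add2[of \<theta>] by (simp add: power2_eq_square add.commute)
  note sc = cs[unfolded add.commute[of "complex_of_real (cos \<theta>) * complex_of_real (cos \<theta>)"]]
  show ?thesis using assms
    by (auto simp: RBS_gate_def mat_of_rows_list_def index_mat_adjoint scalar_prod_def sum_4
        less_4_cases cs sc mult.commute[of "complex_of_real (sin \<theta>)" "complex_of_real (cos \<theta>)"]
        intro!: eq_matI)
qed

section \<open>RBS circuits as real matrices on unary states\<close>

text \<open>Forgets the layers of a butterfly, so that the property passes to tails in inductions
  and to the reversed list.\<close>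

definition rbs_circuit :: "nat \<Rightarrow> nat circuit \<Rightarrow> bool" where
  "rbs_circuit N P \<longleftrightarrow> (\<forall>g\<in>set P. \<exists>\<theta> p q. p < N \<and> q < N \<and> p \<noteq> q \<and> g = RBS_gate \<theta> p q)"

lemma rbs_circuit_rev [simp]: "rbs_circuit N (rev P) \<longleftrightarrow> rbs_circuit N P"
  by (simp add: rbs_circuit_def)

lemma is_gate_rbs_circuit: "rbs_circuit N P \<Longrightarrow> \<forall>g\<in>set P. is_gate g"
  by (auto simp: rbs_circuit_def RBS_gate_def)

lemma circuit_on_rbs_circuit: "rbs_circuit N P \<Longrightarrow> circuit_on {..<N} P"
  by (auto simp: rbs_circuit_def circuit_on_def intro!: valid_RBS_gate)

text \<open>Each gate preserves Hamming weight and has real entries. This makes the unary span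
  invariant and the \<open>Re\<close> in \<open>unary_matrix\<close> exact.\<close>

lemma rbs_circuit_preserves_real_unary:
  assumes "rbs_circuit N P"
    and "\<And>b. \<psi> b \<noteq> 0 \<Longrightarrow> \<exists>i<N. b = {i}" "\<And>b. \<psi> b \<in> \<real>"
  shows "(run P \<psi> b \<noteq> 0 \<longrightarrow> (\<exists>i<N. b = {i})) \<and> run P \<psi> b \<in> \<real>"
  using assms
proof (induction P arbitrary: \<psi>)
  case (Cons g P)
  then obtain \<theta> p q where g: "p < N" "q < N" "p \<noteq> q" "g = RBS_gate \<theta> p q"
    and P: "rbs_circuit N P"
    by (auto simp: rbs_circuit_def)
  have "\<exists>i<N. b = {i}" if "apply_op g \<psi> b \<noteq> 0" for b
  proof (rule ccontr)
    assume *: "\<not> (\<exists>i<N. b = {i})"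
    then have "\<psi> b = 0" using Cons.prems(2) by blast
    \<comment> \<open>The other amplitude in the gate formula vanishes too: moving a bit from
      \<open>s\<close> to \<open>r\<close> reaches a singleton only from \<open>{s}\<close>.\<close>
    moreover have "\<psi> (insert r (b - {s})) = 0" if "s \<in> b" "r \<notin> b" "s < N" for r s
    proof (rule ccontr)
      assume "\<psi> (insert r (b - {s})) \<noteq> 0"
      then obtain i where "insert r (b - {s}) = {i}" using Cons.prems(2) by blast
      then have "b = {s}" using that by auto
      then show False using * that by auto
    qed
    ultimately have "apply_op g \<psi> b = 0" using g by (simp add: apply_RBS_gate)
    then show False using that by simp
  qed
  moreover have "apply_op g \<psi> b \<in> \<real>" for b
    using Cons.prems(3) g by (simp add: apply_RBS_gate)
  ultimately show ?case using Cons.IH[OF P, of "apply_op g \<psi>"] by simp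
qed auto

text \<open>Linearity reduces this to kets of weight one, whose images are real and supported on
  singletons; both sides vanish elsewhere.\<close>

lemma run_rbs_circuit_unary_state:
  assumes "rbs_circuit N P" "x \<in> carrier_vec N"
  shows "run P (unary_state x) =
    unary_state (map_mat complex_of_real (unary_matrix N P) *\<^sub>v x)"
proof
  fix b
  have ket: "(run P (ket {k}) b \<noteq> 0 \<longrightarrow> (\<exists>i<N. b = {i})) \<and> run P (ket {k}) b \<in> \<real>"
    if "k < N" for k
    by (rule rbs_circuit_preserves_real_unary[OF assms(1)])
      (use that in \<open>auto simp: ket_def split: if_splits\<close>)
  have run: "run P (unary_state x) b = (\<Sum>j<N. x $ j * run P (ket {j}) b)"
    using assms(2) by (simp add: unary_state_def run_sum)
  show "run P (unary_state x) b =
      unary_state (map_mat complex_of_real (unary_matrix N P) *\<^sub>v x) b"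
  proof (cases "\<exists>i<N. b = {i}")
    case True
    then obtain i where i: "i < N" "b = {i}" by blast
    have "run P (unary_state x) b = (\<Sum>j<N. complex_of_real (Re (run P (ket {j}) b)) * x $ j)"
      unfolding run using ket by (intro sum.cong) (auto simp: of_real_Re mult.commute)
    then show ?thesis using assms(2) i
      by (simp add: unary_state_singleton unary_matrix_def scalar_prod_def atLeast0LessThan)
  next
    case False
    then have "run P (unary_state x) b = 0" unfolding run using ket by (intro sum.neutral) auto
    moreover have "unary_state (map_mat complex_of_real (unary_matrix N P) *\<^sub>v x) b = 0"
      using False by (intro unary_state_eq_0) (auto simp: unary_matrix_def)
    ultimately show ?thesis by simp
  qed
qed

section \<open>Phase flips and cancellation of angles\<close>

text \<open>The product of Pauli Z gates on \<open>S\<close>, written as a sign on each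
  amplitude.\<close>

definition phase_flip :: "'q set \<Rightarrow> 'q state \<Rightarrow> 'q state" where
  "phase_flip S \<psi> = (\<lambda>b. (- 1) ^ card (b \<inter> S) * \<psi> b)"

lemma phase_flip_phase_flip [simp]: "phase_flip S (phase_flip S \<psi>) = \<psi>"
  by (simp add: phase_flip_def fun_eq_iff flip: mult.assoc power_mult_distrib)

text \<open>Exactly one of \<open>p\<close> and \<open>q\<close> lies in \<open>S\<close>, so moving
  a bit from \<open>p\<close> to \<open>q\<close> changes the number of ones in \<open>S\<close> by
  one.\<close>

lemma parity_swap:
  assumes "finite S" "card ({p, q} \<inter> S) = 1" "p \<in> b" "q \<notin> b"
  shows "(- 1 :: complex) ^ card (insert q (b - {p}) \<inter> S) = - ((- 1) ^ card (b \<inter> S))"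
proof (cases "p \<in> S")
  case True
  then have "q \<notin> S" using assms by (auto simp: Int_insert_left card_insert_if split: if_splits)
  then have "b \<inter> S = insert p (insert q (b - {p}) \<inter> S)" "p \<notin> insert q (b - {p}) \<inter> S"
    using True assms by auto
  then show ?thesis using assms(1) by simp
next
  case False
  then have "q \<in> S" using assms by (auto simp: Int_insert_left card_insert_if split: if_splits)
  then have "insert q (b - {p}) \<inter> S = insert q (b \<inter> S)" "q \<notin> b \<inter> S"
    using False assms by auto
  then show ?thesis using assms(1) by simp
qed

text \<open>Conjugation with the phase flip turns \<open>\<theta>\<close> into \<open>- \<theta>\<close>.\<close>

lemma phase_flip_RBS_gate:
  assumes "finite S" "card ({p, q} \<inter> S) = 1" "p \<noteq> q"
  shows "phase_flip S (apply_op (RBS_gate \<theta> p q)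
    (phase_flip S (apply_op (RBS_gate \<theta> p q) \<psi>))) = \<psi>"
proof
  fix b
  have sq: "(- 1 :: complex) ^ card c * ((- 1) ^ card c * z) = z" for c :: "'a set" and z
    by (simp flip: mult.assoc power_mult_distrib)
  have cs: "complex_of_real (cos \<theta>) * (complex_of_real (cos \<theta>) * z) +
      complex_of_real (sin \<theta>) * (complex_of_real (sin \<theta>) * z) = z" for z
    using sin_cos_squared_add2[of \<theta>]
    by (simp add: power2_eq_square add.commute flip: mult.assoc distrib_right of_real_mult of_real_add)
  \<comment> \<open>In the two mixed cases the sign change makes the sine-cosine products cancel,
    and the squares add up to one.\<close>
  consider "p \<in> b \<longleftrightarrow> q \<in> b" | "p \<notin> b" "q \<in> b" | "p \<in> b" "q \<notin> b" by blast
  then show "phase_flip S (apply_op (RBS_gate \<theta> p q)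
    (phase_flip S (apply_op (RBS_gate \<theta> p q) \<psi>))) b = \<psi> b"
  proof cases
    case 1
    then show ?thesis by (simp add: phase_flip_def apply_RBS_gate assms sq)
  next
    case 2
    have "insert q (insert p (b - {q}) - {p}) = b" using 2 by auto
    then show ?thesis
      using 2 assms parity_swap[of S q p b] cs[of "\<psi> b"]
      by (simp add: phase_flip_def apply_RBS_gate insert_commute algebra_simps sq)
  next
    case 3
    have "insert p (insert q (b - {p}) - {q}) = b" using 3 by auto
    then show ?thesis
      using 3 assms parity_swap[of S p q b] cs[of "\<psi> b"]
      by (simp add: phase_flip_def apply_RBS_gate insert_commute algebra_simps sq)
  qed
qed

text \<open>Gates cancel in nested pairs: the first gate of \<open>P\<close> is the last of
  \<open>rev P\<close>, and the induction hypothesis reduces everything between them to a single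
  phase flip.\<close>

lemma phase_flip_rev_rbs_circuit:
  assumes "finite S" "rbs_circuit N P" "separating_set S P"
  shows "phase_flip S (run (rev P) (phase_flip S (run P \<psi>))) = \<psi>"
  using assms(2,3)
proof (induction P arbitrary: \<psi>)
  case (Cons g P)
  then obtain \<theta> p q where g: "p \<noteq> q" "g = RBS_gate \<theta> p q" "card ({p, q} \<inter> S) = 1"
    by (auto simp: rbs_circuit_def separating_set_def RBS_gate_def)
  let ?\<phi> = "apply_op g \<psi>"
  have "phase_flip S (run (rev P) (phase_flip S (run P ?\<phi>))) = ?\<phi>"
    using Cons.prems by (intro Cons.IH) (auto simp: rbs_circuit_def separating_set_def)
  \<comment> \<open>A phase flip is an involution, so the outer one can be moved to the other
    side.\<close>
  then have "run (rev P) (phase_flip S (run P ?\<phi>)) = phase_flip S ?\<phi>"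
    by (metis phase_flip_phase_flip)
  then show ?case
    using phase_flip_RBS_gate[OF assms(1) g(3) g(1)] g(2) by (simp add: run_append)
qed simp

lemma run_CZ_gates:
  assumes "distinct xs"
  shows "run (map (\<lambda>s. CZ_gate (Inr j) (Inl s)) xs) \<psi> b =
    (if Inr j \<in> b then (- 1) ^ card (Inl -` b \<inter> set xs) else 1) * \<psi> b"
  using assms
  by (induction xs arbitrary: \<psi>) (auto simp: apply_CZ_gate Int_insert_right)

text \<open>The X gates exchange control on 1 for control on 0 and then restore the control qubit,
  so the signs appear exactly when \<open>Inr j\<close> is unset.\<close>

lemma slice_CU_Z:
  assumes "finite S" "B \<inter> range Inl = {}"
  shows "slice Inl B (run (CU_Z j S) \<psi>) =
    (if Inr j \<in> B then slice Inl B \<psi> else phase_flip S (slice Inl B \<psi>))"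
proof -
  have "run (CU_Z j S) \<psi> b = (if Inr j \<in> b then 1 else (- 1) ^ card (Inl -` b \<inter> S)) * \<psi> b" for b
  proof -
    have "Inl -` insert (Inr j) b = Inl -` b" by auto
    moreover have "insert (Inr j) (b - {Inr j}) = b" if "Inr j \<in> b" using that by auto
    moreover have "insert (Inr j) b - {Inr j} = b" if "Inr j \<notin> b" using that by auto
    ultimately show ?thesis
      using assms(1) by (simp add: CU_Z_def run_append apply_X_gate run_CZ_gates)
  qed
  moreover have "Inl -` (B \<union> Inl ` c) = c" "Inr j \<in> B \<union> Inl ` c \<longleftrightarrow> Inr j \<in> B" for c
    using assms(2) by auto
  ultimately show ?thesis by (simp add: slice_def phase_flip_def fun_eq_iff)
qed

section \<open>The Fourier transform\<close>

lemma dim_FT [simp]: "dim_vec (FT x) = dim_vec x"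
  by (simp add: FT_def Let_def)

text \<open>Orthogonality of characters: for \<open>k \<noteq> l\<close> a geometric series whose
  ratio is an \<open>M\<close>-th root of unity different from 1.\<close>

lemma sum_root_unity_powers:
  assumes "k < M" "l < M"
  shows "(\<Sum>j<M. (exp (2 * of_real pi * \<i> / of_nat M) ^ k /
      exp (2 * of_real pi * \<i> / of_nat M) ^ l :: complex) ^ j) = (if k = l then of_nat M else 0)"
proof -
  define w :: complex where "w = exp (2 * of_real pi * \<i> / of_nat M)"
  have M: "M > 0" and w0: "w \<noteq> 0" using assms by (auto simp: w_def)
  have pow: "w ^ n = exp (2 * of_real pi * \<i> * of_nat n / of_nat M)" for n
    by (simp add: w_def mult.commute flip: exp_of_nat_mult)
  have wM: "w ^ M = 1" using M by (simp add: pow)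
  show ?thesis unfolding w_def[symmetric]
  proof (cases "k = l")
    case False
    \<comment> \<open>\<open>w\<close> is a primitive \<open>M\<close>-th root of unity, so distinct
      exponents below \<open>M\<close> give distinct powers.\<close>
    have "w ^ k \<noteq> w ^ l"
      using False assms M complex_root_unity_eq[of M k l] by (simp add: pow cong_def)
    then have ne: "w ^ k / w ^ l \<noteq> 1" using w0 by simp
    have "(w ^ n) ^ M = 1" for n
      using power_mult[of w n M] power_mult[of w M n] by (simp add: wM mult.commute)
    then have "(w ^ k / w ^ l) ^ M = 1" by (simp add: power_divide)
    then show "(\<Sum>j<M. (w ^ k / w ^ l) ^ j) = (if k = l then of_nat M else 0)"
      using False by (simp add: geometric_sum[OF ne])
  qed (simp add: w0)
qed

text \<open>\<open>IFT\<close> is defined as a choice of preimage under \<open>FT\<close>;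
  surjectivity makes it a right inverse.\<close>

lemma FT_surj:
  assumes "y \<in> carrier_vec M" "M > 0"
  shows "\<exists>x\<in>carrier_vec M. FT x = y"
proof
  define w :: complex where "w = exp (2 * of_real pi * \<i> / of_nat M)"
  define r where "r = complex_of_real (sqrt (real M))"
  have rr: "r * r = of_nat M"
    by (simp add: r_def flip: of_real_mult)
  \<comment> \<open>The inverse transform with reciprocal roots of unity; the two factors
    \<open>1 / r\<close> combine to \<open>1 / M\<close>.\<close>
  define x where "x = vec M (\<lambda>j. 1 / r * (\<Sum>l<M. inverse (w ^ l) ^ j * y $ l))"
  show "x \<in> carrier_vec M" by (simp add: x_def)
  show "FT x = y"
  proof (rule eq_vecI)
    fix k assume "k < dim_vec y"
    then have k: "k < M" using assms(1) by simp
    have "FT x $ k = 1 / r * (\<Sum>j<M. w ^ (j * k) * (1 / r * (\<Sum>l<M. inverse (w ^ l) ^ j * y $ l)))"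
      using k by (simp add: FT_def Let_def x_def w_def r_def)
    also have "\<dots> = 1 / (r * r) * (\<Sum>j<M. \<Sum>l<M. (w ^ k / w ^ l) ^ j * y $ l)"
    proof -
      have "1 / r * (w ^ (j * k) * (1 / r * (inverse (w ^ l) ^ j * y $ l))) =
          1 / (r * r) * ((w ^ k / w ^ l) ^ j * y $ l)" for j l
        by (simp add: power_mult_distrib power_inverse field_class.field_divide_inverse
            mult.commute[of j k] power_mult)
      then show ?thesis by (simp only: sum_distrib_left)
    qed
    also have "(\<Sum>j<M. \<Sum>l<M. (w ^ k / w ^ l) ^ j * y $ l) =
        (\<Sum>l<M. (\<Sum>j<M. (w ^ k / w ^ l) ^ j) * y $ l)"
      by (subst sum.swap) (simp add: sum_distrib_right)
    also have "\<dots> = (\<Sum>l<M. if k = l then of_nat M * y $ l else 0)"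
      using k by (intro sum.cong) (simp_all add: w_def sum_root_unity_powers)
    also have "1 / (r * r) * \<dots> = y $ k"
      using k assms(2) by (simp add: rr)
    finally show "FT x $ k = y $ k" .
  qed (use assms(1) in \<open>simp add: x_def\<close>)
qed

lemma FT_IFT:
  assumes "dim_vec y > 0"
  shows "FT (IFT y) = y" "dim_vec (IFT y) = dim_vec y"
proof -
  have y: "y \<in> FT ` carrier_vec (dim_vec y)"
    using FT_surj[OF carrier_vec_dim_vec assms] by blast
  show "FT (IFT y) = y" unfolding IFT_def by (rule f_inv_into_f[OF y])
  show "dim_vec (IFT y) = dim_vec y" unfolding IFT_def using inv_into_into[OF y] by (rule carrier_vecD)
qed

lemma unary_QFT_circuit_on: "unary_QFT M F \<Longrightarrow> circuit_on {..<M} F"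
  by (auto simp: unary_QFT_def gate_circuit_on_def circuit_on_def)

text \<open>\<open>F\<close> sends the state of \<open>IFT y\<close> to that of \<open>y\<close>,
  and the inverse circuit undoes \<open>F\<close>.\<close>

lemma run_inverse_unary_QFT:
  assumes "unary_QFT M F" "y \<in> carrier_vec M" "M > 0"
  shows "run (inverse_circuit F) (unary_state y) = unary_state (IFT y)"
proof -
  have "IFT y \<in> carrier_vec M" "FT (IFT y) = y"
    using FT_IFT[of y] assms by (auto intro: carrier_vecI)
  then have "unary_state y = run F (unary_state (IFT y))"
    using assms(1) by (simp add: unary_QFT_def)
  then show ?thesis
    by (simp add: run_inverse_circuit[OF unary_QFT_circuit_on[OF assms(1)]])
qed

lemma depth_inverse_unary_QFT:
  "unary_QFT M F \<Longrightarrow> depth (inverse_circuit F) \<le> depth F"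
  by (auto simp: unary_QFT_def gate_circuit_on_def intro: depth_inverse_circuit)

section \<open>The Fourier layer\<close>

lemma bit_flip_bit_self: "bit (flip_bit k p) k \<longleftrightarrow> \<not> bit p k" for p :: nat
  by (simp add: bit_flip_bit_iff)

lemma flip_bit_flip_bit: "flip_bit k (flip_bit k p) = p" for p :: nat
  by (rule bit_eqI) (auto simp: bit_flip_bit_iff)

lemma rbs_circuit_butterfly:
  assumes "butterfly a P"
  shows "rbs_circuit (2 ^ a) P"
proof -
  have "\<exists>\<theta> p q. p < 2 ^ a \<and> q < 2 ^ a \<and> p \<noteq> q \<and> g = RBS_gate \<theta> p q" if g: "g \<in> set P" for g
  proof -
    obtain k \<theta> p where "k < a" "p < 2 ^ a" "g = RBS_gate \<theta> p (flip_bit k p)"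
      using assms g by (auto simp: butterfly_def butterfly_layer_def)
    moreover have "p \<noteq> flip_bit k p" using bit_flip_bit_self[of k p] by metis
    ultimately show ?thesis using flip_bit_less by blast
  qed
  then show ?thesis by (simp add: rbs_circuit_def)
qed

text \<open>Flipping bit \<open>k\<close> is an involution pairing labels that have the bit clear
  with labels that have it set, so different gates of a layer share no qubit.\<close>

lemma depth_butterfly_layer: "depth (butterfly_layer a k \<theta>) \<le> 1"
  unfolding butterfly_layer_def RBS_gate_def
proof (rule depth_disjoint_gates)
  fix p p' :: nat
  assume *: "p \<in> set (filter (\<lambda>p. \<not> bit p k) [0..<2 ^ a])"
    "p' \<in> set (filter (\<lambda>p. \<not> bit p k) [0..<2 ^ a])" "p \<noteq> p'"
  have "flip_bit k p \<noteq> flip_bit k p'" using *(3) flip_bit_flip_bit[of k p] flip_bit_flip_bit[of k p'] by metis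
  moreover have "p \<noteq> flip_bit k p'" "flip_bit k p \<noteq> p'"
    using *(1,2) bit_flip_bit_self[of k p] bit_flip_bit_self[of k p'] by auto
  ultimately show "set [p, flip_bit k p] \<inter> set [p', flip_bit k p'] = {}"
    using *(3) by auto
qed simp

lemma depth_butterfly:
  assumes "butterfly a P"
  shows "depth P \<le> a"
proof -
  obtain ks \<theta> where ks: "ks = [0..<a] \<or> ks = rev [0..<a]"
    and P: "P = concat (map (\<lambda>k. butterfly_layer a k (\<theta> k)) ks)"
    using assms by (auto simp: butterfly_def)
  have "depth P \<le> sum_list (map depth (map (\<lambda>k. butterfly_layer a k (\<theta> k)) ks))"
    unfolding P by (rule depth_concat)
  also have "\<dots> \<le> sum_list (map (\<lambda>_. 1) ks)"
    by (simp only: map_map) (intro sum_list_mono, simp add: depth_butterfly_layer[simplified])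
  also have "\<dots> = a" using ks by (auto simp: sum_list_triv)
  finally show ?thesis .
qed

section \<open>The block of one mode and its iteration\<close>

definition fourier_block :: "nat \<Rightarrow> nat circuit \<Rightarrow> nat set \<Rightarrow> (nat + nat) circuit" where
  "fourier_block j P S = embed Inl P @ CU_Z j S @ embed Inl (rev P) @ CU_Z j S"

lemma slice_fourier_block:
  assumes "finite S" "rbs_circuit N P" "separating_set S P" "B \<inter> range Inl = {}"
  shows "slice Inl B (run (fourier_block j P S) \<psi>) =
    (if Inr j \<in> B then run (rev P) (run P (slice Inl B \<psi>)) else slice Inl B \<psi>)"
  using assms
  by (simp add: fourier_block_def run_append slice_CU_Z slice_run_embed phase_flip_rev_rbs_circuit)

text \<open>Column \<open>j\<close> is the slice at \<open>{Inr j}\<close>, where the control is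
  set. Any larger \<open>B\<close> containing \<open>Inr j\<close> has a zero slice, which stays
  zero; with the control unset the block is the identity.\<close>

lemma run_fourier_block:
  assumes "finite S" "rbs_circuit N P" "separating_set S P"
    and "dim_row X = N" "dim_row Y = N" "dim_col Y = dim_col X" "j < dim_col X"
    and "col Y j = map_mat complex_of_real (unary_matrix N (rev P) * unary_matrix N P) *\<^sub>v col X j"
    and "\<And>l. l < dim_col X \<Longrightarrow> l \<noteq> j \<Longrightarrow> col Y l = col X l"
  shows "run (fourier_block j P S) (matrix_state X) = matrix_state Y"
proof (rule eq_if_slices_eq)
  let ?R = "unary_matrix N (rev P)" and ?U = "unary_matrix N P"
  let ?c = "map_mat complex_of_real"
  have carr: "?R \<in> carrier_mat N N" "?U \<in> carrier_mat N N"
    by (simp_all add: unary_matrix_def)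
  have x: "col X j \<in> carrier_vec N" using assms by (auto intro: carrier_vecI)
  have "run (rev P) (run P (unary_state (col X j))) = unary_state (?c ?R *\<^sub>v (?c ?U *\<^sub>v col X j))"
    using carr x assms(2) by (simp add: run_rbs_circuit_unary_state[of N])
  also have "?c ?R *\<^sub>v (?c ?U *\<^sub>v col X j) = col Y j"
    using carr x assms(8) by (simp add: of_real_hom.mat_hom_mult[OF carr] assoc_mult_mat_vec[of _ N N _ N])
  finally have j: "run (rev P) (run P (unary_state (col X j))) = unary_state (col Y j)" .
  fix B :: "(nat + nat) set"
  assume B: "B \<inter> range Inl = {}"
  show "slice Inl B (run (fourier_block j P S) (matrix_state X)) = slice Inl B (matrix_state Y)"
  proof (cases "\<exists>l<dim_col X. B = {Inr l}")
    case True
    then show ?thesis using B assms j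
      by (auto simp: slice_fourier_block[of S N] slice_col)
  next
    case False
    then have "slice Inl B (matrix_state X) = (\<lambda>_. 0)" "slice Inl B (matrix_state Y) = (\<lambda>_. 0)"
      using B assms(6) by (simp_all only: slice_col if_False)
    then show ?thesis using B assms(1-3)
      by (simp add: slice_fourier_block[of S N] run_zero)
  qed
qed

text \<open>Block \<open>j\<close> alters column \<open>j\<close> only, so the blocks replace the
  first \<open>K\<close> columns one after the other.\<close>

lemma run_fourier_blocks:
  assumes "A \<in> carrier_mat N M" "K \<le> M"
    and "\<And>j. j < K \<Longrightarrow> finite (S j) \<and> rbs_circuit N (P j) \<and> separating_set (S j) (P j)"
  defines "W \<equiv> \<lambda>j. unary_matrix N (rev (P j)) * unary_matrix N (P j)"
  shows "run (concat (map (\<lambda>j. fourier_block j (P j) (S j)) [0..<K])) (matrix_state A) =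
    matrix_state (mat N M (\<lambda>(i, j).
      if j < K then (map_mat complex_of_real (W j) *\<^sub>v col A j) $ i else A $$ (i, j)))"
  using assms(2,3)
proof (induction K)
  case 0
  have "A = mat N M (\<lambda>(i, j). A $$ (i, j))" using assms(1) by (intro eq_matI) auto
  then show ?case by simp
next
  case (Suc K)
  let ?Y = "\<lambda>K. mat N M (\<lambda>(i, j).
      if j < K then (map_mat complex_of_real (W j) *\<^sub>v col A j) $ i else A $$ (i, j))"
  have "run (fourier_block K (P K) (S K)) (matrix_state (?Y K)) = matrix_state (?Y (Suc K))"
  proof (rule run_fourier_block[of _ N])
    have W: "W K \<in> carrier_mat N N" by (intro carrier_matI) (simp_all add: W_def unary_matrix_def)
    \<comment> \<open>The preceding blocks have changed only columns below \<open>K\<close>, so this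
      one is still original.\<close>
    have "col (?Y K) K = col A K" using Suc.prems(1) assms(1) by (intro eq_vecI) auto
    moreover have "unary_matrix N (rev (P K)) * unary_matrix N (P K) = W K"
      by (simp add: W_def)
    ultimately show "col (?Y (Suc K)) K =
        map_mat complex_of_real (unary_matrix N (rev (P K)) * unary_matrix N (P K)) *\<^sub>v col (?Y K) K"
      using Suc.prems(1) W by (intro eq_vecI) auto
    show "col (?Y (Suc K)) l = col (?Y K) l" if "l < dim_col (?Y K)" "l \<noteq> K" for l
      using that by (intro eq_vecI) auto
  qed (use Suc.prems in auto)
  moreover have "run (concat (map (\<lambda>j. fourier_block j (P j) (S j)) [0..<K])) (matrix_state A) =
      matrix_state (?Y K)"
    using Suc.prems by (intro Suc.IH) auto
  ultimately show ?case by (simp add: run_append)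
qed

section \<open>Output state of the layer\<close>

lemma sequential_fourier_layer_blocks:
  "sequential_fourier_layer K L F P S =
    L @ embed Inr F @ concat (map (\<lambda>j. fourier_block j (P j) (S j)) [0..<K])
      @ embed Inr (inverse_circuit F)"
  by (simp add: sequential_fourier_layer_def fourier_block_def)

lemma run_sequential_fourier_layer:
  assumes A: "A \<in> carrier_mat N M" and "M > 0" and K: "K \<le> M"
    and L: "loading_circuit A L" and F: "unary_QFT M F"
    and P: "\<And>j. j < K \<Longrightarrow> finite (S j) \<and> rbs_circuit N (P j) \<and> separating_set (S j) (P j)"
  shows "run (sequential_fourier_layer K L F P S) (ket {}) =
    matrix_state (classical_fourier_layer K
      (\<lambda>j. unary_matrix N (rev (P j)) * unary_matrix N (P j)) A)"
proof -
  define W where "W = (\<lambda>j. unary_matrix N (rev (P j)) * unary_matrix N (P j))"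
  \<comment> \<open>\<open>H\<close> is the row-wise transform of \<open>A\<close>, \<open>B\<close>
    its version with the first \<open>K\<close> columns weighted, and \<open>Y\<close> the classical
    output; three equalities of states lead from \<open>A\<close> to \<open>Y\<close>.\<close>
  define R where "R = (\<lambda>i. FT (map_vec complex_of_real (row A i)))"
  define H where "H = mat_of_rows M (map R [0..<N])"
  define B where "B = (\<lambda>i j. if j < K then (map_mat complex_of_real (W j) *\<^sub>v col H j) $ i else H $$ (i, j))"
  define Y where "Y = classical_fourier_layer K W A"
  have R: "R i \<in> carrier_vec M" if "i < N" for i
    using that A by (auto simp: R_def intro!: carrier_vecI)
  have H: "H \<in> carrier_mat N M" by (intro carrier_matI) (simp_all add: H_def)
  have rowH: "row H i = R i" if "i < N" for i
    unfolding H_def using that R by (subst mat_of_rows_row) auto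
  have Y_eq: "Y = mat_of_rows M (map (\<lambda>i. IFT (vec M (B i))) [0..<N])"
    unfolding Y_def classical_fourier_layer_def Let_def B_def H_def R_def carrier_matD[OF A] ..
  have I: "IFT (vec M (B i)) \<in> carrier_vec M" for i
    using FT_IFT(2)[of "vec M (B i)"] \<open>M > 0\<close> by (auto intro: carrier_vecI)
  have Y: "Y \<in> carrier_mat N M" by (intro carrier_matI) (simp_all add: Y_eq)
  have rowY: "row Y i = IFT (vec M (B i))" if "i < N" for i
    unfolding Y_eq using that I by (subst mat_of_rows_row) auto
  have "run (embed Inr F) (matrix_state (map_mat complex_of_real A)) = matrix_state H"
  proof (rule run_embed_rows)
    fix i assume "i < dim_row (map_mat complex_of_real A)"
    then have i: "i < N" using A by simp
    have "row (map_mat complex_of_real A) i = map_vec complex_of_real (row A i)"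
      using i A by (intro eq_vecI) auto
    moreover have "map_vec complex_of_real (row A i) \<in> carrier_vec M"
      using i A by auto
    ultimately show "run F (unary_state (row (map_mat complex_of_real A) i)) = unary_state (row H i)"
      using F i by (simp add: unary_QFT_def rowH R_def)
  qed (use A H in auto)
  moreover have "run (concat (map (\<lambda>j. fourier_block j (P j) (S j)) [0..<K])) (matrix_state H) =
      matrix_state (mat N M (\<lambda>(i, j). B i j))"
    unfolding B_def W_def using H K P by (rule run_fourier_blocks)
  moreover have "run (embed Inr (inverse_circuit F)) (matrix_state (mat N M (\<lambda>(i, j). B i j))) =
      matrix_state Y"
  proof (rule run_embed_rows)
    fix i assume "i < dim_row (mat N M (\<lambda>(i, j). B i j))"
    then have i: "i < N" by simp
    have "row (mat N M (\<lambda>(i, j). B i j)) i = vec M (B i)"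
      using i by (intro eq_vecI) auto
    then show "run (inverse_circuit F) (unary_state (row (mat N M (\<lambda>(i, j). B i j)) i)) =
        unary_state (row Y i)"
      using i \<open>M > 0\<close> by (simp add: rowY run_inverse_unary_QFT[OF F])
  qed (use Y in auto)
  ultimately show ?thesis
    using L by (simp add: sequential_fourier_layer_blocks run_append loading_circuit_def
        flip: W_def Y_def)
qed

section \<open>Validity and depth of the layer\<close>

lemma circuit_on_CU_Z:
  assumes "S \<subseteq> {..<N}" "j < M"
  shows "circuit_on (registers N M) (CU_Z j S)"
proof -
  have "finite S" using assms(1) finite_subset by blast
  then show ?thesis using assms
    by (auto simp: CU_Z_def circuit_on_def registers_def intro!: valid_X_gate valid_CZ_gate)
qed

text \<open>All gates share the control qubit, so nothing is lost by counting them: one for each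
  element of \<open>S\<close> and two X gates.\<close>

lemma depth_CU_Z:
  assumes "S \<subseteq> {..<N}"
  shows "depth (CU_Z j S) \<le> N + 2"
proof -
  have "card S \<le> N" using card_mono[OF _ assms] by simp
  then show ?thesis using depth_le_length[of "CU_Z j S"] by (simp add: CU_Z_def)
qed

lemma circuit_on_fourier_block:
  assumes "rbs_circuit N P" "S \<subseteq> {..<N}" "j < M"
  shows "circuit_on (registers N M) (fourier_block j P S)"
proof -
  have "circuit_on (registers N M) (embed Inl C)" if "rbs_circuit N C" for C
    by (rule circuit_on_embed[OF _ circuit_on_rbs_circuit[OF that]]) (auto simp: registers_def)
  then show ?thesis
    using assms by (simp add: fourier_block_def circuit_on_append circuit_on_CU_Z)
qed

lemma depth_fourier_block:
  assumes "butterfly a P" "S \<subseteq> {..<2 ^ a}"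
  shows "depth (fourier_block j P S) \<le> 2 * a + 2 * (2 ^ a + 2)"
proof -
  have rbs: "rbs_circuit (2 ^ a) P" by (rule rbs_circuit_butterfly[OF assms(1)])
  then have rev: "rbs_circuit (2 ^ a) (rev P)" by simp
  \<comment> \<open>\<open>rev P\<close> also reverses the order within each layer; its bound comes
    from reversal invariance of depth instead of the butterfly form.\<close>
  have d: "depth P \<le> a" "depth (rev P) \<le> a"
    using depth_butterfly[OF assms(1)] depth_rev[OF is_gate_rbs_circuit[OF rbs]] by auto
  have "depth (embed Inl P :: (nat + nat) circuit) \<le> a"
    using depth_embed[OF inj_Inl circuit_on_rbs_circuit[OF rbs]] d(1) by (rule order_trans)
  moreover have "depth (embed Inl (rev P) :: (nat + nat) circuit) \<le> a"
    using depth_embed[OF inj_Inl circuit_on_rbs_circuit[OF rev]] d(2) by (rule order_trans)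
  moreover have "depth (CU_Z j S) \<le> 2 ^ a + 2" by (rule depth_CU_Z[OF assms(2)])
  ultimately have "depth (fourier_block j P S) \<le> a + ((2 ^ a + 2) + (a + (2 ^ a + 2)))"
    unfolding fourier_block_def by (intro order_trans[OF depth_append add_mono])
  then show ?thesis by simp
qed

lemma circuit_on_sequential_fourier_layer:
  assumes "A \<in> carrier_mat N M" "K \<le> M" "loading_circuit A L" "unary_QFT M F"
    and "\<And>j. j < K \<Longrightarrow> rbs_circuit N (P j) \<and> S j \<subseteq> {..<N}"
  shows "circuit_on (registers N M) (sequential_fourier_layer K L F P S)"
proof -
  have "circuit_on (registers N M) (embed Inr C)" if "circuit_on {..<M} C" for C
    by (rule circuit_on_embed[OF _ that]) (auto simp: registers_def)
  moreover have "circuit_on (registers N M) (concat (map (\<lambda>j. fourier_block j (P j) (S j)) [0..<K]))"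
  proof -
    have "circuit_on (registers N M) (fourier_block j (P j) (S j))" if "j < K" for j
      using assms(2,5) that by (intro circuit_on_fourier_block) auto
    then show ?thesis by (auto simp: circuit_on_def)
  qed
  ultimately show ?thesis
    using assms(1,3) unary_QFT_circuit_on[OF assms(4)]
    by (auto simp: sequential_fourier_layer_blocks circuit_on_append loading_circuit_def
        gate_circuit_on_def circuit_on_inverse_circuit)
qed

lemma depth_sequential_fourier_layer:
  assumes F: "unary_QFT M F"
    and P: "\<And>j. j < K \<Longrightarrow> butterfly m (P j) \<and> S j \<subseteq> {..<2 ^ m}"
  shows "depth (sequential_fourier_layer K L F P S) \<le>
    depth L + 2 * depth F + K * (2 * m + 2 * (2 ^ m + 2))"
proof -
  let ?b = "\<lambda>j. fourier_block j (P j) (S j)"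
  have FQ: "circuit_on {..<M} F" by (rule unary_QFT_circuit_on[OF F])
  have "depth (embed Inr F :: (nat + nat) circuit) \<le> depth F"
    by (rule depth_embed[OF _ FQ]) simp
  moreover have "depth (embed Inr (inverse_circuit F) :: (nat + nat) circuit) \<le> depth F"
    using depth_embed[OF inj_Inr circuit_on_inverse_circuit[OF FQ]] depth_inverse_unary_QFT[OF F]
    by (rule order_trans)
  moreover have "depth (concat (map ?b [0..<K])) \<le> K * (2 * m + 2 * (2 ^ m + 2))"
  proof -
    have "depth (concat (map ?b [0..<K])) \<le> sum_list (map depth (map ?b [0..<K]))"
      by (rule depth_concat)
    also have "\<dots> \<le> sum_list (map (\<lambda>_. 2 * m + 2 * (2 ^ m + 2)) [0..<K])"
      unfolding map_map comp_def using P by (intro sum_list_mono depth_fourier_block) auto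
    finally show ?thesis by (simp add: sum_list_triv)
  qed
  ultimately show ?thesis
    using depth_append[of L "embed Inr F @ concat (map ?b [0..<K]) @ embed Inr (inverse_circuit F)"]
      depth_append[of "embed Inr F" "concat (map ?b [0..<K]) @ embed Inr (inverse_circuit F)"]
      depth_append[of "concat (map ?b [0..<K])" "embed Inr (inverse_circuit F)"]
    unfolding sequential_fourier_layer_blocks by linarith
qed

text \<open>\<open>cL\<close> and \<open>cF\<close> are the constants in the assumed depth bounds
  for loading and for the transform. They are fixed before \<open>C\<close>, which is therefore
  uniform in all sizes, angles, circuits and inputs.\<close>

theorem mainTheorem2:
  fixes cL cF :: real
  shows "\<exists>C :: real. \<forall>(m :: nat) (n :: nat) Nc Ns K (A :: real mat) L F P S.
    Nc = 2 ^ m \<and> Ns = 2 ^ n \<and> Nc \<ge> 2 \<and> Ns \<ge> 2 \<and> 1 \<le> K \<and> K \<le> Ns \<and>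
    A \<in> carrier_mat Nc Ns \<and> (\<Sum>i<Nc. \<Sum>j<Ns. (A $$ (i, j))\<^sup>2) = 1 \<and>
    loading_circuit A L \<and>
    real (depth L) \<le> cL * (log 2 (real Nc) + real Nc * log 2 (real Ns)) \<and>
    unary_QFT Ns F \<and> real (depth F) \<le> cF * log 2 (real Ns) \<and>
    (\<forall>j<K. butterfly m (P j) \<and> S j \<subseteq> {..<Nc} \<and> separating_set (S j) (P j))
    \<longrightarrow>
    (let Q = sequential_fourier_layer K L F P S;
         W = (\<lambda>j. unary_matrix Nc (rev (P j)) * unary_matrix Nc (P j))
     in circuit_on (registers Nc Ns) Q \<and>
        run Q (ket {}) = matrix_state (classical_fourier_layer K W A) \<and>
        real (depth Q) \<le> C * (real K * real Nc + real Nc * log 2 (real Ns)))"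
\<comment> \<open>The loading bound contributes \<open>2 * \<bar>cL\<bar>\<close>, the transform and
  its inverse \<open>2 * \<bar>cF\<bar>\<close>, and the blocks 6. Absolute values allow for
  negative \<open>cL\<close> and \<open>cF\<close>.\<close>
proof (intro exI[of _ "2 * \<bar>cL\<bar> + 2 * \<bar>cF\<bar> + 6"] allI impI, elim conjE)
  fix m n Nc Ns K :: nat and A :: "real mat" and L F P S
  assume Nc: "Nc = 2 ^ m" and Ns: "Ns = 2 ^ n" and Nc2: "Nc \<ge> 2" and Ns2: "Ns \<ge> 2"
    and K: "K \<le> Ns" and A: "A \<in> carrier_mat Nc Ns" and L: "loading_circuit A L"
    and dL: "real (depth L) \<le> cL * (log 2 (real Nc) + real Nc * log 2 (real Ns))"
    and F: "unary_QFT Ns F" and dF: "real (depth F) \<le> cF * log 2 (real Ns)"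
    and P: "\<forall>j<K. butterfly m (P j) \<and> S j \<subseteq> {..<Nc} \<and> separating_set (S j) (P j)"
  define Q where "Q = sequential_fourier_layer K L F P S"
  have P': "finite (S j) \<and> rbs_circuit Nc (P j) \<and> separating_set (S j) (P j)" if "j < K" for j
    using P that Nc finite_subset[of "S j" "{..<Nc}"] by (auto intro: rbs_circuit_butterfly)
  have "circuit_on (registers Nc Ns) Q"
    unfolding Q_def using A K L F P P' by (intro circuit_on_sequential_fourier_layer) auto
  moreover have "run Q (ket {}) = matrix_state (classical_fourier_layer K
      (\<lambda>j. unary_matrix Nc (rev (P j)) * unary_matrix Nc (P j)) A)"
    unfolding Q_def using A Ns2 K L F P' by (intro run_sequential_fourier_layer) auto
  moreover have "real (depth Q) \<le>
      (2 * \<bar>cL\<bar> + 2 * \<bar>cF\<bar> + 6) * (real K * real Nc + real Nc * log 2 (real Ns))"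
  proof -
    define x where "x = real Nc * log 2 (real Ns)"
    have n: "log 2 (real Ns) = real n" "n \<ge> 1"
      using Ns Ns2 by (simp_all, cases n, simp_all)
    have m: "log 2 (real Nc) = real m" "m \<le> Nc"
      by (simp_all add: Nc less_imp_le)
    \<comment> \<open>Since \<open>n \<ge> 1\<close>, \<open>x\<close> dominates \<open>Nc\<close>
      and with it \<open>log 2 Nc\<close>, which is at most \<open>Nc\<close>.\<close>
    have "real Nc * 1 \<le> x" unfolding x_def n using n(2) by (intro mult_left_mono) auto
    then have mx: "log 2 (real Nc) \<le> x" using m by simp
    have "1 * real n \<le> x" unfolding x_def n using Nc2 by (intro mult_right_mono) auto
    then have nx: "log 2 (real Ns) \<le> x" by (simp add: n)
    have x0: "0 \<le> x" by (simp add: x_def n)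
    have "cL * (log 2 (real Nc) + x) \<le> \<bar>cL\<bar> * (log 2 (real Nc) + x)"
      using m x0 by (intro mult_right_mono) auto
    then have "real (depth L) \<le> \<bar>cL\<bar> * (log 2 (real Nc) + x)"
      using dL unfolding x_def by linarith
    also have "\<dots> \<le> \<bar>cL\<bar> * (x + x)" using mx by (intro mult_left_mono) auto
    finally have L': "real (depth L) \<le> 2 * \<bar>cL\<bar> * x" by simp
    have "cF * log 2 (real Ns) \<le> \<bar>cF\<bar> * log 2 (real Ns)"
      using n by (intro mult_right_mono) auto
    then have "real (depth F) \<le> \<bar>cF\<bar> * log 2 (real Ns)" using dF by linarith
    also have "\<dots> \<le> \<bar>cF\<bar> * x" using nx by (intro mult_left_mono) auto
    finally have F': "real (depth F) \<le> \<bar>cF\<bar> * x" .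
    have "depth Q \<le> depth L + 2 * depth F + K * (2 * m + 2 * (Nc + 2))"
      unfolding Q_def Nc using F P Nc by (intro depth_sequential_fourier_layer) auto
    \<comment> \<open>From \<open>m \<le> Nc\<close> and \<open>4 \<le> 2 * Nc\<close>, each block
      has depth at most \<open>6 * Nc\<close>.\<close>
    also have "\<dots> \<le> depth L + 2 * depth F + K * (6 * Nc)"
      using m(2) Nc2 by (intro add_left_mono mult_left_mono) auto
    finally have "real (depth Q) \<le> real (depth L + 2 * depth F + K * (6 * Nc))"
      by (rule of_nat_mono)
    then have "real (depth Q) \<le> real (depth L) + 2 * real (depth F) + 6 * (real K * real Nc)"
      by simp
    also have "\<dots> \<le> (2 * \<bar>cL\<bar> + 2 * \<bar>cF\<bar>) * x + 6 * (real K * real Nc)"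
      using L' F' by (simp add: algebra_simps)
    also have "\<dots> \<le> (2 * \<bar>cL\<bar> + 2 * \<bar>cF\<bar> + 6) * (real K * real Nc + x)"
      using x0 by (simp add: algebra_simps)
    finally show ?thesis by (simp add: x_def)
  qed
  ultimately show "let Q = sequential_fourier_layer K L F P S;
         W = (\<lambda>j. unary_matrix Nc (rev (P j)) * unary_matrix Nc (P j))
     in circuit_on (registers Nc Ns) Q \<and>
        run Q (ket {}) = matrix_state (classical_fourier_layer K W A) \<and>
        real (depth Q) \<le> (2 * \<bar>cL\<bar> + 2 * \<bar>cF\<bar> + 6) * (real K * real Nc + real Nc * log 2 (real Ns))"
    by (simp add: Q_def Let_def)
qed

end
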